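(* Let $\mathsf{P}$ be the Promislow group with generating set $\{a,b\}$. Every unit of $\mathbb{Z}[\mathsf{P}]$ whose support lies in the ball $B(3)$ is trivial.
   Context: The Promislow (Hantzsche--Wendt) group is $\mathsf{P}=\langle a,b\mid b^{-1}a^2b=a^{-2},\ a^{-1}b^2a=b^{-2}\rangle$. For an integer $r\ge 0$, $B(r)$ is the set of elements of $\mathsf{P}$ of word length at most $r$ with respect to the generating set $\{a,b\}$ (inverses allowed). For $u=\sum_g u_g\,g\in\mathbb{Z}[\mathsf{P}]$, the support is $\operatorname{supp}(u)=\{g: u_g\ne 0\}$. A unit of $\mathbb{Z}[\mathsf{P}]$ is trivial if it equals $\pm g$ for some $g\in\mathsf{P}$. *)

theory Defs
  imports Main "HOL-Library.Poly_Mapping"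
begin

section \<open>Groups given by generators and relations\<close>

text \<open>
  A word over the generators is a list of letters; \<open>(x, True)\<close> stands for the generator \<open>x\<close> and
  \<open>(x, False)\<close> for its formal inverse. A relation \<open>l = r\<close> between words is the pair \<open>(l, r)\<close>.
\<close>

type_synonym 'g word = "('g \<times> bool) list"

inductive pres_eq :: "('g word \<times> 'g word) set \<Rightarrow> 'g word \<Rightarrow> 'g word \<Rightarrow> bool"
  for R where
  refl: "pres_eq R w w"
| sym: "pres_eq R w w' \<Longrightarrow> pres_eq R w' w"
| trans: "pres_eq R w w' \<Longrightarrow> pres_eq R w' w'' \<Longrightarrow> pres_eq R w w''"
| cancel: "pres_eq R (u @ [(x, e), (x, \<not> e)] @ v) (u @ v)"
| relation: "(l, r) \<in> R \<Longrightarrow> pres_eq R (u @ l @ v) (u @ r @ v)"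

definition inv_word :: "'g word \<Rightarrow> 'g word" where
  "inv_word w = rev (map (\<lambda>(x, e). (x, \<not> e)) w)"

lemma equivp_pres_eq: "equivp (pres_eq R)"
  by (rule equivpI) (auto simp: reflp_def symp_def transp_def
        intro: pres_eq.refl pres_eq.sym pres_eq.trans)

lemma pres_eq_context: "pres_eq R w w' \<Longrightarrow> pres_eq R (p @ w @ q) (p @ w' @ q)"
proof (induction rule: pres_eq.induct)
  case (refl w)
  show ?case by (rule pres_eq.refl)
next
  case (sym w w')
  then show ?case by (blast intro: pres_eq.sym)
next
  case (trans w w' w'')
  then show ?case by (blast intro: pres_eq.trans)
next
  case (cancel u x e v)
  show ?case using pres_eq.cancel[of R "p @ u" x e "v @ q"] by simp
next
  case (relation l r u v)
  then show ?case using pres_eq.relation[of l r R "p @ u" "v @ q"] by simp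
qed

lemma pres_eq_append:
  assumes "pres_eq R w w'" "pres_eq R z z'"
  shows "pres_eq R (w @ z) (w' @ z')"
  using pres_eq_context[OF assms(1), of "[]" z] pres_eq_context[OF assms(2), of w' "[]"]
  by (auto intro: pres_eq.trans)

lemma inv_word_simps [simp]:
  "inv_word [] = []"
  "inv_word (w @ z) = inv_word z @ inv_word w"
  "inv_word ((x, e) # w) = inv_word w @ [(x, \<not> e)]"
  "inv_word (inv_word w) = w"
  by (auto simp: inv_word_def rev_map comp_def case_prod_beta)

lemma pres_eq_inv_left: "pres_eq R (inv_word w @ w) []"
proof (induction w)
  case Nil
  show ?case by (simp add: pres_eq.refl)
next
  case (Cons a w)
  obtain x e where a: "a = (x, e)" by (cases a)
  have "pres_eq R (inv_word w @ [(x, \<not> e), (x, \<not> \<not> e)] @ w) (inv_word w @ w)"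
    by (rule pres_eq.cancel)
  with Cons show ?case by (auto simp: a intro: pres_eq.trans)
qed

lemma pres_eq_inv_right: "pres_eq R (w @ inv_word w) []"
  using pres_eq_inv_left[of R "inv_word w"] by simp

lemma pres_eq_inv_word:
  assumes "pres_eq R w w'"
  shows "pres_eq R (inv_word w) (inv_word w')"
proof -
  have "pres_eq R (inv_word w @ w' @ inv_word w') (inv_word w @ w @ inv_word w')"
    by (rule pres_eq_context[OF pres_eq.sym[OF assms]])
  moreover have "pres_eq R (inv_word w @ w' @ inv_word w') (inv_word w)"
    using pres_eq_append[OF pres_eq.refl[of R "inv_word w"] pres_eq_inv_right[of R w']] by simp
  moreover have "pres_eq R (inv_word w @ w @ inv_word w') (inv_word w')"
    using pres_eq_append[OF pres_eq_inv_left[of R w] pres_eq.refl[of R "inv_word w'"]] by simp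
  ultimately show ?thesis by (blast intro: pres_eq.sym pres_eq.trans)
qed


section \<open>The Promislow group\<close>

datatype gen = Gen_a | Gen_b

text \<open>The relations \<open>b\<^sup>-\<^sup>1 a\<^sup>2 b = a\<^sup>-\<^sup>2\<close> and \<open>a\<^sup>-\<^sup>1 b\<^sup>2 a = b\<^sup>-\<^sup>2\<close>.\<close>

definition promislow_rels :: "(gen word \<times> gen word) set" where
  "promislow_rels =
    {([(Gen_b, False), (Gen_a, True), (Gen_a, True), (Gen_b, True)],
      [(Gen_a, False), (Gen_a, False)]),
     ([(Gen_a, False), (Gen_b, True), (Gen_b, True), (Gen_a, True)],
      [(Gen_b, False), (Gen_b, False)])}"

quotient_type promislow = "gen word" / "pres_eq promislow_rels"
  by (rule equivp_pres_eq)

text \<open>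
  The group is written additively, since the monoid algebra of the library, the type
  \<open>'a \<Rightarrow>\<^sub>0 'b\<close> of finitely supported functions with convolution as multiplication, expects
  its exponents in class \<^class>\<open>monoid_add\<close>. The class \<^class>\<open>group_add\<close> does not assume
  commutativity.
\<close>

instantiation promislow :: group_add
begin

lift_definition zero_promislow :: promislow is "[]" .

lift_definition plus_promislow :: "promislow \<Rightarrow> promislow \<Rightarrow> promislow" is "(@)"
  by (rule pres_eq_append)

lift_definition uminus_promislow :: "promislow \<Rightarrow> promislow" is inv_word
  by (rule pres_eq_inv_word)

definition minus_promislow :: "promislow \<Rightarrow> promislow \<Rightarrow> promislow" where
  "minus_promislow g h = g + - h"

instance
proof
  fix g h k :: promislow
  show "g + h + k = g + (h + k)" by transfer (simp add: pres_eq.refl)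
  show "0 + g = g" by transfer (simp add: pres_eq.refl)
  show "g + 0 = g" by transfer (simp add: pres_eq.refl)
  show "- g + g = 0" by transfer (rule pres_eq_inv_left)
  show "g + - h = g - h" by (simp add: minus_promislow_def)
qed

end

lift_definition P_a :: promislow is "[(Gen_a, True)]" .

lift_definition P_b :: promislow is "[(Gen_b, True)]" .

lemma promislow_relations:
  "- P_b + (P_a + P_a) + P_b = - (P_a + P_a)"
  "- P_a + (P_b + P_b) + P_a = - (P_b + P_b)"
  by (transfer, use pres_eq.relation[of _ _ promislow_rels "[]" "[]"]
      in \<open>simp add: promislow_rels_def\<close>)+

text \<open>
  The elements that are products of at most \<open>r\<close> factors from \<open>S\<close> and the inverses of \<open>S\<close>,
  that is, the elements of word length at most \<open>r\<close>.
\<close>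

definition word_ball :: "'a::group_add set \<Rightarrow> nat \<Rightarrow> 'a set" where
  "word_ball S r = {sum_list xs | xs. set xs \<subseteq> S \<union> uminus ` S \<and> length xs \<le> r}"


section \<open>Units of group rings\<close>

definition is_ring_unit :: "'a::ring_1 \<Rightarrow> bool" where
  "is_ring_unit u \<longleftrightarrow> (\<exists>v. u * v = 1 \<and> v * u = 1)"

text \<open>\<open>Poly_Mapping.single g 1\<close> is the group element \<open>g\<close> inside the group ring.\<close>

definition is_trivial_unit :: "('g::group_add \<Rightarrow>\<^sub>0 int) \<Rightarrow> bool" where
  "is_trivial_unit u \<longleftrightarrow>
    (\<exists>g. u = Poly_Mapping.single g 1 \<or> u = - Poly_Mapping.single g 1)"

end

theory Submission
  imports Defs "HOL-Library.Product_Lexorder" "HOL-Library.Product_Plus"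
    "HOL-Computational_Algebra.Polynomial_Factorial"
begin

text \<open>
  Write \<open>x = a\<^sup>2\<close>, \<open>y = b\<^sup>2\<close> and let \<open>A = \<int>[x\<^sup>\<plusminus>\<^sup>1, y\<^sup>\<plusminus>\<^sup>1]\<close>. The subgroup \<open>\<langle>x, y\<rangle>\<close> is free abelian and normal
  with infinite dihedral quotient, so the group ring is a crossed product of \<open>A\<close> with the infinite
  dihedral group: as an \<open>A\<close>-module it is free on the alternating words in \<open>a\<close> and \<open>b\<close>, and
  conjugation by \<open>a\<close> and \<open>b\<close> acts on \<open>A\<close> by \<open>\<sigma>: y \<mapsto> y\<^sup>-\<^sup>1\<close> and \<open>\<tau>: x \<mapsto> x\<^sup>-\<^sup>1\<close>. An element of the ball of
  radius 3 only involves alternating words of length at most 3. The theorem holds for every unit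
  \<open>u\<close> of this shape; no bound on the coefficients in \<open>A\<close> is used, and a right inverse \<open>v\<close> suffices.

  The argument imitates the theory of units in a coproduct of skew fields, over the ring \<open>A\<close>
  itself. Alternating words are indexed by integers so that the word of index \<open>k\<close> has length \<open>\<bar>k\<bar>\<close>.
  Comparing extremal indices in \<open>u v = 1\<close> gives the following facts.

  \<^item> The coefficients of \<open>aba\<close> and \<open>bab\<close> in \<open>u\<close> are not both nonzero (\<open>extremal_product\<close>). By
    symmetry let the coefficient of \<open>bab\<close> be zero.
  \<^item> If \<open>u\<close> is not in \<open>A + A a\<close>, then \<open>u = d + e\<^sub>1 k b e\<close>, where \<open>d, e\<^sub>1, e\<close> lie in \<open>A + A a\<close>, \<open>k \<noteq> 0\<close>
    lies in \<open>A\<close>, and the two coefficients of \<open>e\<close> are coprime, as are those of \<open>e\<^sub>1\<close> when written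
    to the right of \<open>a\<close>. Here \<open>e\<close> is the primitive part of the conjugate of the extremal part
    of \<open>v\<close>.
  \<^item> With \<open>e\<^sub>1'\<close> the conjugate and \<open>N = e\<^sub>1' e\<^sub>1 \<in> A\<close> the norm of \<open>e\<^sub>1\<close>, one more comparison gives
    \<open>e\<^sub>1' u = (\<kappa> + H b) e\<close> with \<open>\<kappa>, H = N k \<in> A\<close>.

  Now let \<open>U = \<kappa> \<tau>(\<kappa>) - y H \<tau>(H)\<close> be the norm of \<open>\<kappa> + H b\<close>. Multiplying \<open>(\<kappa> + H b) e v = e\<^sub>1'\<close> by
  the conjugate of \<open>\<kappa> + H b\<close> shows that \<open>U\<close> divides all coefficients of \<open>(\<tau>(\<kappa>) - H b) e\<^sub>1'\<close>; since
  \<open>e\<^sub>1\<close> is primitive, \<open>U\<close> divides \<open>\<kappa>\<close> and \<open>H\<close>, hence \<open>U\<^sup>2\<close> divides \<open>U\<close> and \<open>U\<close> is a unit of \<open>A\<close>. The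
  degrees in \<open>y\<close> of the two summands of \<open>U\<close> have different parities, so \<open>\<kappa> = 0\<close> or \<open>H = 0\<close>
  (\<open>norm_not_unit\<close>). As \<open>H \<noteq> 0\<close>, this leaves \<open>\<kappa> = 0\<close>, so \<open>N\<close> and \<open>k\<close> are units, and likewise \<open>e\<^sub>1\<close>
  and \<open>e\<close> have only one nonzero coefficient, a unit (\<open>unit_monomial\<close>). The units of \<open>A\<close> are plus or
  minus monomials, so \<open>u\<close> is trivial. For \<open>u\<close> in \<open>A + A a\<close> the same divisibility argument applies to
  the norm of \<open>u\<close> itself (\<open>monomial_of_right_inverse\<close>).

  Primitive parts exist because \<open>A\<close> is a localization of the factorial ring \<open>\<int>[x, y]\<close>
  (\<open>laurent_primitive\<close>). The description of the group ring rests on a normal form in the group,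
  whose uniqueness is read off from a homomorphism to an explicit group structure on \<open>\<int>\<^sup>3\<close>.
\<close>

section \<open>Coprime pairs\<close>

text \<open>
  Coprimality of \<open>f\<close> and \<open>g\<close> as it is used for denominators: the solutions \<open>(h, k)\<close> of
  \<open>h f = k g\<close> are exactly the multiples of \<open>(g, f)\<close>. In a domain this excludes \<open>f = g = 0\<close>.
\<close>

definition coprime_pair :: "'a::comm_ring_1 \<Rightarrow> 'a \<Rightarrow> bool" where
  "coprime_pair f g \<longleftrightarrow> (\<forall>h k. h * f = k * g \<longrightarrow> (\<exists>d. h = d * g \<and> k = d * f))"

lemma coprime_pairD:
  assumes "coprime_pair f g" "h * f = k * g"
  obtains d where "h = d * g" "k = d * f"
  using assms unfolding coprime_pair_def by blast

lemma coprime_pair_nonzero: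
  assumes "coprime_pair f (g::'a::idom)"
  shows "f \<noteq> 0 \<or> g \<noteq> 0"
proof (rule ccontr)
  assume "\<not> ?thesis"
  then have fg: "f = 0" "g = 0" by auto
  then have "1 * f = 1 * g" by simp
  then obtain d where "1 = d * g" by (rule coprime_pairD[OF assms])
  then show False using fg by simp
qed

lemma coprime_pair_dvd:
  fixes U :: "'a::idom"
  assumes "coprime_pair f g" "U \<noteq> 0" "U dvd k * f" "U dvd k * g"
  shows "U dvd k"
proof -
  obtain s t where s: "k * f = U * s" and t: "k * g = U * t"
    using assms(3,4) by (auto elim!: dvdE)
  have "U * (t * f) = U * (s * g)"
    using s t by (metis mult.assoc mult.commute)
  then have "t * f = s * g" using \<open>U \<noteq> 0\<close> by simp
  then obtain d where d: "t = d * g" "s = d * f"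
    by (rule coprime_pairD[OF assms(1)])
  have "k * f = U * d * f" "k * g = U * d * g"
    using s t d by (simp_all add: mult_ac)
  then have "k = U * d"
    using coprime_pair_nonzero[OF assms(1)] by auto
  then show ?thesis by simp
qed

section \<open>Crossed products with the infinite dihedral group\<close>

text \<open>
  The sign \<open>(-1)\<^sup>k\<close>.
\<close>

abbreviation (input) parity_sign :: "int \<Rightarrow> int" where
  "parity_sign k \<equiv> (if even k then 1 else - 1)"

text \<open>
  A ring with a commutative coefficient domain, embedded by \<open>\<iota>\<close>, and two invertible elements
  \<open>a\<close> and \<open>b\<close> whose squares are coefficients and which normalize the coefficients, acting by
  involutions \<open>\<sigma>\<close> and \<open>\<tau>\<close>. It is graded over the infinite dihedral group, whose elements are
  numbered by integers: \<open>0, 1, 2, 3, \<dots>\<close> stand for \<open>1, a, ab, aba, \<dots>\<close> and \<open>-1, -2, -3, \<dots>\<close> for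
  \<open>b, ba, bab, \<dots>\<close>. In this numbering the product of \<open>k\<close> and \<open>l\<close> is \<open>k + (-1)\<^sup>k l\<close>, and exchanging
  \<open>a\<close> and \<open>b\<close> is \<open>k \<mapsto> -k\<close>. The predicate \<open>layer k\<close> describes the homogeneous elements of index
  \<open>k\<close>, and \<open>pr k\<close> is the projection to them.

  The assumptions \<open>norm_x\<close> and \<open>norm_y\<close> say that the norms of \<open>f + g a\<close> and \<open>f + g b\<close> are nonzero
  nonunits as soon as \<open>f\<close> and \<open>g\<close> are nonzero.
\<close>

locale dihedral_crossed =
  fixes \<iota> :: "'l::idom \<Rightarrow> 's::ring_1"
    and \<sigma> \<tau> :: "'l \<Rightarrow> 'l"
    and x y :: 'l
    and a b :: 's
    and layer :: "int \<Rightarrow> 's \<Rightarrow> bool"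
    and pr :: "int \<Rightarrow> 's \<Rightarrow> 's"
  assumes \<iota>_add: "\<iota> (f + g) = \<iota> f + \<iota> g"
    and \<iota>_mult: "\<iota> (f * g) = \<iota> f * \<iota> g"
    and \<iota>_one: "\<iota> 1 = 1"
    and \<iota>_zeroD: "\<iota> f = 0 \<Longrightarrow> f = 0"
    and \<sigma>_add: "\<sigma> (f + g) = \<sigma> f + \<sigma> g"
    and \<sigma>_mult: "\<sigma> (f * g) = \<sigma> f * \<sigma> g"
    and \<sigma>_inv: "\<sigma> (\<sigma> f) = f"
    and \<tau>_add: "\<tau> (f + g) = \<tau> f + \<tau> g"
    and \<tau>_mult: "\<tau> (f * g) = \<tau> f * \<tau> g"
    and \<tau>_inv: "\<tau> (\<tau> f) = f"
    and \<sigma>_\<tau>: "\<sigma> (\<tau> f) = \<tau> (\<sigma> f)"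
    and a_\<iota>: "a * \<iota> f = \<iota> (\<sigma> f) * a"
    and b_\<iota>: "b * \<iota> f = \<iota> (\<tau> f) * b"
    and a_a: "a * a = \<iota> x"
    and b_b: "b * b = \<iota> y"
    and \<sigma>_x: "\<sigma> x = x"
    and \<tau>_y: "\<tau> y = y"
    and x_unit: "x dvd 1"
    and y_unit: "y dvd 1"
    and norm_x: "f \<noteq> 0 \<Longrightarrow> g \<noteq> 0 \<Longrightarrow>
      f * \<sigma> f - x * (g * \<sigma> g) \<noteq> 0 \<and> \<not> f * \<sigma> f - x * (g * \<sigma> g) dvd 1"
    and norm_y: "f \<noteq> 0 \<Longrightarrow> g \<noteq> 0 \<Longrightarrow>
      f * \<tau> f - y * (g * \<tau> g) \<noteq> 0 \<and> \<not> f * \<tau> f - y * (g * \<tau> g) dvd 1"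
    and primitive: "f \<noteq> 0 \<or> g \<noteq> 0 \<Longrightarrow>
      \<exists>c f' g'. f = c * f' \<and> g = c * g' \<and> coprime_pair f' g'"
    and layer_\<iota>: "layer 0 (\<iota> f)"
    and layer_a: "layer 1 a"
    and layer_b: "layer (- 1) b"
    and layer_mult: "layer k s \<Longrightarrow> layer l t \<Longrightarrow> layer (k + parity_sign k * l) (s * t)"
    and layer_0: "layer 0 s \<Longrightarrow> \<exists>f. s = \<iota> f"
    and layer_basis: "\<exists>w w'. w * w' = 1 \<and> w' * w = 1 \<and> (\<forall>s. layer k s \<longrightarrow> (\<exists>f. s = \<iota> f * w))"
    and layer_pr: "layer k (pr k v)"
    and pr_same: "layer k s \<Longrightarrow> pr k s = s"
    and pr_other: "layer k s \<Longrightarrow> j \<noteq> k \<Longrightarrow> pr j s = 0"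
    and pr_add: "pr k (v + w) = pr k v + pr k w"
    and pr_mult: "layer k s \<Longrightarrow> pr j (s * v) = s * pr (parity_sign k * (j - k)) v"
    and pr_zeroD: "(\<And>k. pr k v = 0) \<Longrightarrow> v = 0"
    and finite_pr: "finite {k. pr k v \<noteq> 0}"
begin

lemma \<iota>_0 [simp]: "\<iota> 0 = 0"
  using \<iota>_add[of 0 0] by simp

lemma \<iota>_minus: "\<iota> (- f) = - \<iota> f"
  using \<iota>_add[of f "- f"] by (simp add: eq_neg_iff_add_eq_0 add.commute)

lemma \<iota>_diff: "\<iota> (f - g) = \<iota> f - \<iota> g"
  using \<iota>_add[of f "- g"] by (simp add: \<iota>_minus)

lemma \<iota>_inj: "\<iota> f = \<iota> g \<Longrightarrow> f = g"
  using \<iota>_zeroD[of "f - g"] by (simp add: \<iota>_diff)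

lemma \<sigma>_0 [simp]: "\<sigma> 0 = 0"
  using \<sigma>_add[of 0 0] by (metis add_cancel_right_right)

lemma \<tau>_0 [simp]: "\<tau> 0 = 0"
  using \<tau>_add[of 0 0] by (metis add_cancel_right_right)

lemma \<sigma>_minus: "\<sigma> (- f) = - \<sigma> f"
  using \<sigma>_add[of f "- f"] by (simp add: eq_neg_iff_add_eq_0 add.commute)

lemma \<tau>_minus: "\<tau> (- f) = - \<tau> f"
  using \<tau>_add[of f "- f"] by (simp add: eq_neg_iff_add_eq_0 add.commute)

lemma \<sigma>_diff: "\<sigma> (f - g) = \<sigma> f - \<sigma> g"
  using \<sigma>_add[of f "- g"] by (simp add: \<sigma>_minus)

lemma \<tau>_diff: "\<tau> (f - g) = \<tau> f - \<tau> g"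
  using \<tau>_add[of f "- g"] by (simp add: \<tau>_minus)

lemma \<sigma>_eq_0 [simp]: "\<sigma> f = 0 \<longleftrightarrow> f = 0"
  by (metis \<sigma>_0 \<sigma>_inv)

lemma \<tau>_eq_0 [simp]: "\<tau> f = 0 \<longleftrightarrow> f = 0"
  by (metis \<tau>_0 \<tau>_inv)

lemma x_nz [simp]: "x \<noteq> 0" and y_nz [simp]: "y \<noteq> 0"
  using x_unit y_unit by auto

lemma coprime_pair_\<sigma>: "coprime_pair f g \<Longrightarrow> coprime_pair (\<sigma> f) (\<sigma> g)"
  unfolding coprime_pair_def by (metis \<sigma>_inv \<sigma>_mult)

lemma coprime_pair_\<tau>: "coprime_pair f g \<Longrightarrow> coprime_pair (\<tau> f) (\<tau> g)"
  unfolding coprime_pair_def by (metis \<tau>_inv \<tau>_mult)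

lemma a_\<iota>': "a * (\<iota> f * s) = \<iota> (\<sigma> f) * (a * s)"
  by (metis a_\<iota> mult.assoc)

lemma b_\<iota>': "b * (\<iota> f * s) = \<iota> (\<tau> f) * (b * s)"
  by (metis b_\<iota> mult.assoc)

lemma a_a': "a * (a * s) = \<iota> x * s"
  by (metis a_a mult.assoc)

lemma b_b': "b * (b * s) = \<iota> y * s"
  by (metis b_b mult.assoc)

lemma \<iota>_mult': "\<iota> f * (\<iota> g * s) = \<iota> (f * g) * s"
  by (simp add: \<iota>_mult mult.assoc)

text \<open>
  Rewriting with these rules moves all coefficients to the left and merges them.
\<close>

lemmas push = a_\<iota> a_\<iota>' b_\<iota> b_\<iota>' a_a a_a' b_b b_b' \<iota>_mult[symmetric] \<iota>_mult'
  \<sigma>_mult \<tau>_mult \<sigma>_inv \<tau>_inv \<sigma>_\<tau> \<sigma>_x \<tau>_y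

lemma ex_inverse_a: "\<exists>a'. a * a' = 1 \<and> a' * a = 1"
proof -
  obtain x' where x': "x * x' = 1" using x_unit by (metis dvdE)
  have "\<iota> x' * a * a = 1"
    by (metis a_a \<iota>_mult \<iota>_one mult.assoc mult.commute x')
  moreover have "a * (a * \<iota> x') = 1"
    by (metis a_a \<iota>_mult \<iota>_one mult.assoc x')
  ultimately show ?thesis by (metis mult.assoc mult_1_left mult_1_right)
qed

lemma ex_inverse_b: "\<exists>b'. b * b' = 1 \<and> b' * b = 1"
proof -
  obtain y' where y': "y * y' = 1" using y_unit by (metis dvdE)
  have "\<iota> y' * b * b = 1"
    by (metis b_b \<iota>_mult \<iota>_one mult.assoc mult.commute y')
  moreover have "b * (b * \<iota> y') = 1"
    by (metis b_b \<iota>_mult \<iota>_one mult.assoc y')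
  ultimately show ?thesis by (metis mult.assoc mult_1_left mult_1_right)
qed

lemma mult_a_cancel [simp]: "s * a = t * a \<longleftrightarrow> s = t" "a * s = a * t \<longleftrightarrow> s = t"
  using ex_inverse_a by (metis mult.assoc mult_1_right, metis mult.assoc mult_1_left)

lemma mult_b_cancel [simp]: "s * b = t * b \<longleftrightarrow> s = t" "b * s = b * t \<longleftrightarrow> s = t"
  using ex_inverse_b by (metis mult.assoc mult_1_right, metis mult.assoc mult_1_left)

lemma mult_a_0 [simp]: "s * a = 0 \<longleftrightarrow> s = 0" "a * s = 0 \<longleftrightarrow> s = 0"
  using mult_a_cancel[of s 0] mult_a_cancel[of 0 s] by (metis mult_zero_left mult_zero_right mult_a_cancel)+

lemma mult_b_0 [simp]: "s * b = 0 \<longleftrightarrow> s = 0" "b * s = 0 \<longleftrightarrow> s = 0"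
  by (metis mult_zero_left mult_zero_right mult_b_cancel)+

lemma layer_aM: "layer k s \<Longrightarrow> layer (1 - k) (a * s)"
  using layer_mult[OF layer_a, of k s] by simp

lemma layer_bM: "layer k s \<Longrightarrow> layer (- 1 - k) (b * s)"
  using layer_mult[OF layer_b, of k s] by simp

lemma pr_0 [simp]: "pr k 0 = 0"
  using pr_add[of k 0 0] by simp

lemma pr_minus: "pr k (- v) = - pr k v"
  using pr_add[of k v "- v"] by (simp add: eq_neg_iff_add_eq_0 add.commute)

lemma pr_diff: "pr k (v - w) = pr k v - pr k w"
  using pr_add[of k v "- w"] by (simp add: pr_minus)

lemma pr_\<iota>: "pr j (\<iota> f * v) = \<iota> f * pr j v"
  using pr_mult[OF layer_\<iota>[of f], of j v] by simp

lemma pr_a: "pr j (a * v) = a * pr (1 - j) v"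
  using pr_mult[OF layer_a, of j v] by simp

lemma pr_b: "pr j (b * v) = b * pr (- 1 - j) v"
  using pr_mult[OF layer_b, of j v] by (simp add: minus_diff_commute)

lemma layer_1: "layer 0 1"
  using layer_\<iota>[of 1] by (simp add: \<iota>_one)

lemma pr_1: "pr j 1 = (if j = 0 then 1 else 0)"
  using layer_1 by (simp add: pr_same pr_other)

lemma pr_\<iota>0: "pr j (\<iota> f) = (if j = 0 then \<iota> f else 0)"
  using layer_\<iota>[of f] by (simp add: pr_same pr_other)

lemma pr_a0: "pr j a = (if j = 1 then a else 0)"
  using layer_a by (simp add: pr_same pr_other)

lemma pr_b0: "pr j b = (if j = - 1 then b else 0)"
  using layer_b by (simp add: pr_same pr_other)

lemmas pr_simps = pr_add pr_diff pr_minus pr_\<iota> pr_a pr_b pr_1 pr_\<iota>0 pr_a0 pr_b0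

lemma layer_\<iota>_zeroD:
  assumes "layer k s" "\<iota> f * s = 0"
  shows "f = 0 \<or> s = 0"
proof -
  obtain w w' g where w: "w * w' = 1" "s = \<iota> g * w"
    using layer_basis[of k] assms(1) by blast
  have "\<iota> (f * g) = \<iota> f * s * w'"
    using w by (simp add: \<iota>_mult mult.assoc)
  then have "f * g = 0" using assms(2) by (intro \<iota>_zeroD) simp
  then show ?thesis using w by auto
qed

lemma layer_1_coeff:
  assumes "layer 1 s" shows "\<exists>f. s = \<iota> f * a"
proof -
  obtain x' where x': "x' * x = 1" using x_unit by (metis dvdE mult.commute)
  have "layer 0 (a * s)" using layer_aM[OF assms] by simp
  then obtain f where f: "a * s = \<iota> f" using layer_0 by blast
  have "a * (\<iota> (\<sigma> (f * x')) * a) = \<iota> f"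
    using x' by (simp add: push mult.assoc)
  then show ?thesis using f by (metis mult_a_cancel(2))
qed

lemma layer_m1_coeff:
  assumes "layer (- 1) s" shows "\<exists>f. s = \<iota> f * b"
proof -
  obtain y' where y': "y' * y = 1" using y_unit by (metis dvdE mult.commute)
  have "layer 0 (b * s)" using layer_bM[OF assms] by simp
  then obtain f where f: "b * s = \<iota> f" using layer_0 by blast
  have "b * (\<iota> (\<tau> (f * y')) * b) = \<iota> f"
    using y' by (simp add: push mult.assoc)
  then show ?thesis using f by (metis mult_b_cancel(2))
qed

lemma layer_m2_coeff:
  assumes "layer (- 2) s" shows "\<exists>f. s = \<iota> f * (b * a)"
proof -
  have "layer 1 (b * s)" using layer_bM[OF assms] by simp
  then obtain f where f: "b * s = \<iota> f * a" using layer_1_coeff by blast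
  obtain y' where y': "y * y' = 1" using y_unit by (metis dvdE)
  have "b * (\<iota> (\<tau> (f * y')) * (b * a)) = \<iota> (f * y' * y) * a"
    by (simp add: push mult_ac)
  also have "f * y' * y = f" using y' by (simp add: mult_ac)
  finally show ?thesis using f by (metis mult_b_cancel(2))
qed

lemma norm_x_nonzero:
  assumes "f \<noteq> 0 \<or> g \<noteq> 0" shows "f * \<sigma> f - x * (g * \<sigma> g) \<noteq> 0"
  using norm_x[of f g] assms by (cases "f = 0"; cases "g = 0") auto

lemma norm_y_nonzero:
  assumes "f \<noteq> 0 \<or> g \<noteq> 0" shows "f * \<tau> f - y * (g * \<tau> g) \<noteq> 0"
  using norm_y[of f g] assms by (cases "f = 0"; cases "g = 0") auto

text \<open>
  The multiplicative monoid generated by the unit coefficients and by \<open>a\<close> and \<open>b\<close>; in the group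
  ring its elements are the trivial units.
\<close>

inductive monomial :: "'s \<Rightarrow> bool" where
  scalar: "f dvd 1 \<Longrightarrow> monomial (\<iota> f)"
| a: "monomial a"
| b: "monomial b"
| mult: "monomial s \<Longrightarrow> monomial t \<Longrightarrow> monomial (s * t)"

lemma monomial_norm_unit:
  assumes "f * \<sigma> f - x * (g * \<sigma> g) dvd 1"
  shows "monomial (\<iota> f + \<iota> g * a)"
proof -
  have "f = 0 \<or> g = 0" using norm_x assms by blast
  then show ?thesis
  proof
    assume "f = 0"
    then have "x * \<sigma> g * g dvd 1" using assms by (simp add: mult_ac)
    then have "g dvd 1" by (rule dvd_mult_right)
    then show ?thesis using \<open>f = 0\<close> monomial.intros by simp
  next
    assume "g = 0"
    then have "f dvd 1" using assms by (auto elim: dvd_mult_left)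
    then show ?thesis using \<open>g = 0\<close> monomial.intros by simp
  qed
qed

text \<open>
  The conjugate of \<open>f + g a\<close> is \<open>\<sigma>(f) - g a\<close>; multiplied from either side it gives the norm.
\<close>

lemma conj_mult:
  "(\<iota> (\<sigma> f) - \<iota> g * a) * (\<iota> f + \<iota> g * a) = \<iota> (f * \<sigma> f - x * (g * \<sigma> g))"
proof -
  have "(\<iota> (\<sigma> f) - \<iota> g * a) * (\<iota> f + \<iota> g * a)
     = \<iota> (\<sigma> f * f) + \<iota> (\<sigma> f * g) * a - \<iota> (g * \<sigma> f) * a - \<iota> (g * \<sigma> g * x)"
    by (simp add: algebra_simps push)
  then show ?thesis by (simp add: mult_ac \<iota>_diff)
qed

lemma mult_conj:
  "(\<iota> f + \<iota> g * a) * (\<iota> (\<sigma> f) - \<iota> g * a) = \<iota> (f * \<sigma> f - x * (g * \<sigma> g))"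
proof -
  have "(\<iota> f + \<iota> g * a) * (\<iota> (\<sigma> f) - \<iota> g * a)
     = \<iota> (f * \<sigma> f) + \<iota> (g * f) * a - \<iota> (f * g) * a - \<iota> (g * \<sigma> g * x)"
    by (simp add: algebra_simps push)
  then show ?thesis by (simp add: mult_ac \<iota>_diff)
qed

text \<open>
  One-sided units of \<open>A + A a\<close> are monomial, even when the inverse is sought in the whole ring:
  the norm \<open>N\<close> divides both coefficients of \<open>f + g a\<close>, so \<open>N\<^sup>2\<close> divides \<open>N\<close>.
\<close>

lemma monomial_of_right_inverse:
  assumes "(\<iota> f + \<iota> g * a) * q = 1"
  shows "monomial (\<iota> f + \<iota> g * a)"
proof -
  define N where "N = f * \<sigma> f - x * (g * \<sigma> g)"
  have Nq: "\<iota> N * q = \<iota> (\<sigma> f) - \<iota> g * a"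
    using assms conj_mult[of f g] unfolding N_def by (metis mult.assoc mult_1_right)
  obtain q0 where q0: "pr 0 q = \<iota> q0" using layer_0 layer_pr by blast
  obtain q1 where q1: "pr 1 q = \<iota> q1 * a" using layer_1_coeff layer_pr by blast
  have "\<iota> N * pr 0 q = \<iota> (\<sigma> f)"
    using arg_cong[OF Nq, of "pr 0"] by (simp add: pr_simps)
  then have "\<iota> (N * q0) = \<iota> (\<sigma> f)" by (simp add: q0 \<iota>_mult)
  then have f: "\<sigma> f = N * q0" using \<iota>_inj by metis
  have "\<iota> N * pr 1 q = - \<iota> g * a"
    using arg_cong[OF Nq, of "pr 1"] by (simp add: pr_simps)
  then have "\<iota> (N * q1) * a = \<iota> (- g) * a"
    by (simp only: q1 \<iota>_mult \<iota>_minus mult.assoc)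
  then have "\<iota> (N * q1) = \<iota> (- g)" by simp
  then have "N * q1 = - g" by (rule \<iota>_inj)
  then have g: "g = - (N * q1)" by simp
  have \<sigma>N: "\<sigma> N = N"
    unfolding N_def by (simp add: \<sigma>_diff \<sigma>_mult \<sigma>_inv \<sigma>_x mult_ac)
  have f': "f = N * \<sigma> q0" using f by (metis \<sigma>N \<sigma>_inv \<sigma>_mult)
  have "N \<noteq> 0"
  proof
    assume "N = 0"
    then have "f = 0 \<and> g = 0" using norm_x_nonzero[of f g] unfolding N_def by auto
    then show False using assms by simp
  qed
  have "N = f * \<sigma> f - x * (g * \<sigma> g)" by (rule N_def)
  also have "\<dots> = N * \<sigma> q0 * (N * q0) - x * (- (N * q1) * \<sigma> (- (N * q1)))"
    by (simp only: flip: f f' g)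
  also have "\<dots> = N * (N * (q0 * \<sigma> q0 - x * (q1 * \<sigma> q1)))"
    by (simp add: \<sigma>N \<sigma>_minus \<sigma>_mult algebra_simps)
  finally have "N = N * (N * (q0 * \<sigma> q0 - x * (q1 * \<sigma> q1)))" .
  then have "N * (q0 * \<sigma> q0 - x * (q1 * \<sigma> q1)) = 1"
    using \<open>N \<noteq> 0\<close> by (metis mult_cancel_left1)
  then have "N dvd 1" by (metis dvd_triv_left)
  then show ?thesis unfolding N_def by (rule monomial_norm_unit)
qed

text \<open>
  The indices \<open>k\<close> and \<open>1 - k\<close> are exchanged by left multiplication with \<open>a\<close>. Thus the layers of
  \<open>v\<close> are grouped into cosets of \<open>A + A a\<close>, and \<open>{K, 1 - K}\<close> is the outermost coset that occurs.
\<close>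

lemma extremal_layer:
  assumes "v \<noteq> 0"
  obtains K where "K \<le> 0" "\<And>k. k < K \<or> 1 - K < k \<Longrightarrow> pr k v = 0"
    "pr K v \<noteq> 0 \<or> pr (1 - K) v \<noteq> 0"
proof -
  define S where "S = {k. pr k v \<noteq> 0}"
  define M where "M = (\<lambda>k::int. min k (1 - k)) ` S"
  have "finite M" using finite_pr by (simp add: M_def S_def)
  moreover have "S \<noteq> {}" using assms pr_zeroD unfolding S_def by blast
  ultimately have "Min M \<in> M" unfolding M_def by (intro Min_in) auto
  then obtain k where k: "k \<in> S" "Min M = min k (1 - k)" unfolding M_def by auto
  have le: "Min M \<le> min j (1 - j)" if "pr j v \<noteq> 0" for j
    using that \<open>finite M\<close> unfolding M_def S_def by (intro Min_le) auto
  show ?thesis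
  proof (rule that[of "Min M"])
    show "Min M \<le> 0" using k(2) by (auto simp: min_def)
    show "pr j v = 0" if "j < Min M \<or> 1 - Min M < j" for j
      using le[of j] that by (cases "pr j v = 0") auto
    show "pr (Min M) v \<noteq> 0 \<or> pr (1 - Min M) v \<noteq> 0"
      using k unfolding S_def by (auto simp: min_def split: if_splits)
  qed
qed

text \<open>
  An element with nonzero coefficients at both \<open>aba\<close> and \<open>bab\<close> strictly increases the length of
  everything that it multiplies.
\<close>

lemma extremal_product:
  assumes uv: "u * v = 1"
    and u: "u = \<iota> p + \<iota> q * a + \<iota> r * b + \<iota> s * (a * b) + \<iota> t * (b * a)
      + \<iota> m * (a * (b * a)) + \<iota> l * (b * (a * b))"
  shows "m = 0 \<or> l = 0"
proof (rule ccontr)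
  assume "\<not> ?thesis"
  then have ml: "m \<noteq> 0" "l \<noteq> 0" by auto
  have "v \<noteq> 0" using uv by auto
  then obtain K where K: "K \<le> 0" "\<And>k. k < K \<or> 1 - K < k \<Longrightarrow> pr k v = 0"
    "pr K v \<noteq> 0 \<or> pr (1 - K) v \<noteq> 0" by (rule extremal_layer) blast
  \<comment> \<open>Only \<open>bab\<close> maps a layer of \<open>v\<close> to index \<open>K - 4\<close>, namely layer \<open>1 - K\<close>.\<close>
  have "pr (K - 4) (u * v) = 0" using K(1) by (simp add: uv pr_1)
  then have "\<iota> l * (b * (a * (b * pr (1 - K) v))) = 0"
    using K(1) by (simp add: u distrib_right mult.assoc pr_simps K(2) algebra_simps)
  moreover have "layer (K - 4) (b * (a * (b * pr (1 - K) v)))"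
    using layer_bM[OF layer_aM[OF layer_bM[OF layer_pr[of "1 - K" v]]]] by (simp add: algebra_simps)
  ultimately have 1: "pr (1 - K) v = 0"
    using layer_\<iota>_zeroD ml by fastforce
  have "pr (3 - K) (u * v) = 0" using K(1) by (simp add: uv pr_1)
  then have "\<iota> m * (a * (b * (a * pr K v))) = 0"
    using K(1) 1 by (simp add: u distrib_right mult.assoc pr_simps K(2) algebra_simps)
  moreover have "layer (3 - K) (a * (b * (a * pr K v)))"
    using layer_aM[OF layer_bM[OF layer_aM[OF layer_pr[of K v]]]] by (simp add: algebra_simps)
  ultimately have "pr K v = 0"
    using layer_\<iota>_zeroD ml by fastforce
  then show False using K(3) 1 by simp
qed

lemma monomial_invertible: "monomial s \<Longrightarrow> \<exists>t. s * t = 1 \<and> t * s = 1"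
proof (induction rule: monomial.induct)
  case (scalar f)
  then obtain g where "f * g = 1" by (metis dvdE)
  then show ?case by (metis \<iota>_mult \<iota>_one mult.commute)
next
  case a
  show ?case by (rule ex_inverse_a)
next
  case b
  show ?case by (rule ex_inverse_b)
next
  case (mult s t)
  then obtain s' t' where "s * s' = 1 \<and> s' * s = 1" "t * t' = 1 \<and> t' * t = 1" by blast
  then have "(s * t) * (t' * s') = 1 \<and> (t' * s') * (s * t) = 1"
    by (metis mult.assoc mult_1_right)
  then show ?case by blast
qed

text \<open>
  The extremal part of \<open>v\<close> is \<open>(g + h a) w\<close> with \<open>w\<close> invertible. The two relations are the
  vanishing of the \<open>a\<close>-part and of the scalar part of \<open>(c + d a) (g + h a)\<close>.
\<close>

lemma extremal_pair:
  assumes "pr K v \<noteq> 0 \<or> pr (1 - K) v \<noteq> 0"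
  obtains g h where "g \<noteq> 0 \<or> h \<noteq> 0"
    "\<And>c d. \<iota> d * (a * pr K v) + \<iota> c * pr (1 - K) v = 0 \<Longrightarrow> d * \<sigma> g + c * h = 0"
    "\<And>c d. \<iota> c * pr K v + \<iota> d * (a * pr (1 - K) v) = 0 \<Longrightarrow> c * g + d * (x * \<sigma> h) = 0"
proof -
  obtain w w' where w: "w * w' = 1" and basis: "\<And>s. layer K s \<Longrightarrow> \<exists>f. s = \<iota> f * w"
    using layer_basis[of K] by blast
  obtain g where g: "pr K v = \<iota> g * w" using basis layer_pr by blast
  have "layer K (a * pr (1 - K) v)" using layer_aM[OF layer_pr, of "1 - K"] by simp
  then obtain h' where h': "a * pr (1 - K) v = \<iota> h' * w" using basis by blast
  obtain x' where x': "x' * x = 1" using x_unit by (metis dvdE mult.commute)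
  define h where "h = \<sigma> (h' * x')"
  have "a * (\<iota> h * (a * w)) = a * pr (1 - K) v"
    using x' unfolding h' h_def by (simp add: push mult.assoc)
  then have h: "pr (1 - K) v = \<iota> h * (a * w)" by simp
  have w0: "f = 0" if "\<iota> f * w = 0" for f
  proof -
    have "\<iota> f * w * w' = 0" using that by simp
    then show ?thesis using w \<iota>_zeroD by (simp add: mult.assoc)
  qed
  show ?thesis
  proof (rule that[of g h])
    show "g \<noteq> 0 \<or> h \<noteq> 0" using assms g h by auto
    show "d * \<sigma> g + c * h = 0" if "\<iota> d * (a * pr K v) + \<iota> c * pr (1 - K) v = 0" for c d
    proof -
      have "a * (\<iota> (\<sigma> (d * \<sigma> g + c * h)) * w) = 0"
        using that by (simp add: g h push \<iota>_add distrib_right distrib_left \<sigma>_add mult.assoc)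
      then have "\<iota> (\<sigma> (d * \<sigma> g + c * h)) * w = 0" by simp
      then show ?thesis using w0 \<sigma>_eq_0 by blast
    qed
    show "c * g + d * (x * \<sigma> h) = 0" if "\<iota> c * pr K v + \<iota> d * (a * pr (1 - K) v) = 0" for c d
    proof -
      have "\<iota> (c * g + d * (x * \<sigma> h)) * w = 0"
        using that by (simp add: g h push \<iota>_add distrib_right mult_ac)
      then show ?thesis by (rule w0)
    qed
  qed
qed

lemma annihilator_zero:
  assumes "g \<noteq> 0 \<or> h \<noteq> 0" "d * \<sigma> g + c * h = 0" "c * g + d * (x * \<sigma> h) = 0"
  shows "c = 0 \<and> d = 0"
proof -
  have N: "g * \<sigma> g - x * (h * \<sigma> h) \<noteq> 0" by (rule norm_x_nonzero[OF assms(1)])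
  have "c * (g * \<sigma> g - x * (h * \<sigma> h)) =
      \<sigma> g * (c * g + d * (x * \<sigma> h)) - x * \<sigma> h * (d * \<sigma> g + c * h)" by algebra
  then have "c = 0" using N assms(2,3) by simp
  then show ?thesis using assms by auto
qed

text \<open>
  The factorization argument. In the statement the coefficient of \<open>bab\<close> is zero; the other case
  follows by exchanging \<open>a\<close> and \<open>b\<close>.
\<close>

lemma unit_monomial:
  assumes uv: "u * v = 1"
    and u: "u = \<iota> p + \<iota> q * a + \<iota> r * b + \<iota> s * (a * b) + \<iota> t * (b * a)
      + \<iota> m * (a * (b * a))"
  shows "monomial u"
proof (cases "r = 0 \<and> s = 0 \<and> t = 0 \<and> m = 0")
  case True
  then show ?thesis using uv monomial_of_right_inverse[of p q v] by (simp add: u)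
next
  case nontrivial: False
  have "v \<noteq> 0" using uv by auto
  then obtain K where K: "K \<le> 0" "\<And>k. k < K \<or> 1 - K < k \<Longrightarrow> pr k v = 0"
    "pr K v \<noteq> 0 \<or> pr (1 - K) v \<noteq> 0" by (rule extremal_layer) blast
  obtain g h where gh: "g \<noteq> 0 \<or> h \<noteq> 0"
    and rel1: "\<And>c d. \<iota> d * (a * pr K v) + \<iota> c * pr (1 - K) v = 0 \<Longrightarrow> d * \<sigma> g + c * h = 0"
    and rel2: "\<And>c d. \<iota> c * pr K v + \<iota> d * (a * pr (1 - K) v) = 0 \<Longrightarrow> c * g + d * (x * \<sigma> h) = 0"
    using extremal_pair[OF K(3)] by metis
  \<comment> \<open>Write \<open>u = d0 + b d1 + ab d2\<close> with \<open>di\<close> in \<open>A + A a\<close>, and let \<open>g + h a\<close> be the extremal part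
     of \<open>v\<close>. The facts \<open>top\<close> and \<open>bot\<close> say that \<open>d2 (g + h a)\<close> and \<open>d1 (g + h a)\<close> lie in \<open>A\<close>.\<close>
  have top: "\<tau> (\<sigma> m) * \<sigma> g + \<tau> (\<sigma> s) * h = 0"
  proof (rule rel1)
    have "pr (3 - K) (u * v) = 0" using K(1) by (simp add: uv pr_1)
    then have "\<iota> s * (a * (b * pr (1 - K) v)) + \<iota> m * (a * (b * (a * pr K v))) = 0"
      using K(1) by (simp add: u distrib_right mult.assoc pr_simps K(2) algebra_simps)
    then have "a * (b * (\<iota> (\<tau> (\<sigma> m)) * (a * pr K v) + \<iota> (\<tau> (\<sigma> s)) * pr (1 - K) v)) = 0"
      by (simp add: push distrib_left add.commute)
    then show "\<iota> (\<tau> (\<sigma> m)) * (a * pr K v) + \<iota> (\<tau> (\<sigma> s)) * pr (1 - K) v = 0" by simp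
  qed
  have bot: "\<tau> t * \<sigma> g + \<tau> r * h = 0"
  proof (rule rel1)
    have "pr (K - 2) (u * v) = 0" using K(1) by (simp add: uv pr_1)
    then have "\<iota> r * (b * pr (1 - K) v) + \<iota> t * (b * (a * pr K v)) = 0"
      using K(1) by (simp add: u distrib_right mult.assoc pr_simps K(2) algebra_simps)
    then have "b * (\<iota> (\<tau> t) * (a * pr K v) + \<iota> (\<tau> r) * pr (1 - K) v) = 0"
      by (simp add: push distrib_left add.commute)
    then show "\<iota> (\<tau> t) * (a * pr K v) + \<iota> (\<tau> r) * pr (1 - K) v = 0" by simp
  qed
  \<comment> \<open>If \<open>v\<close> were in \<open>A + A a\<close>, then \<open>d1 v = d2 v = 0\<close>, hence \<open>d1 = d2 = 0\<close>.\<close>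
  have "K \<noteq> 0"
  proof
    assume "K = 0"
    note K0 = K(2)[unfolded \<open>K = 0\<close>, simplified]
    have "\<tau> r * g + \<tau> t * (x * \<sigma> h) = 0"
    proof (rule rel2)
      have "pr (- 1) (u * v) = 0" by (simp add: uv pr_1)
      then have "\<iota> r * (b * pr 0 v) + \<iota> t * (b * (a * pr 1 v)) = 0"
        by (simp add: u distrib_right mult.assoc pr_simps K0)
      then have "b * (\<iota> (\<tau> r) * pr 0 v + \<iota> (\<tau> t) * (a * pr 1 v)) = 0"
        by (simp add: push distrib_left)
      then show "\<iota> (\<tau> r) * pr K v + \<iota> (\<tau> t) * (a * pr (1 - K) v) = 0"
        by (simp add: \<open>K = 0\<close>)
    qed
    then have "\<tau> r = 0 \<and> \<tau> t = 0" by (rule annihilator_zero[OF gh bot])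
    moreover have "\<tau> (\<sigma> s) * g + \<tau> (\<sigma> m) * (x * \<sigma> h) = 0"
    proof (rule rel2)
      have "pr 2 (u * v) = 0" by (simp add: uv pr_1)
      then have "\<iota> s * (a * (b * pr 0 v)) + \<iota> m * (a * (b * (a * pr 1 v))) = 0"
        by (simp add: u distrib_right mult.assoc pr_simps K0)
      then have "a * (b * (\<iota> (\<tau> (\<sigma> s)) * pr 0 v + \<iota> (\<tau> (\<sigma> m)) * (a * pr 1 v))) = 0"
        by (simp add: push distrib_left)
      then show "\<iota> (\<tau> (\<sigma> s)) * pr K v + \<iota> (\<tau> (\<sigma> m)) * (a * pr (1 - K) v) = 0"
        by (simp add: \<open>K = 0\<close>)
    qed
    then have "\<tau> (\<sigma> s) = 0 \<and> \<tau> (\<sigma> m) = 0" by (rule annihilator_zero[OF gh top])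
    ultimately show False using nontrivial by simp
  qed
  then have "K < 0" using K(1) by simp

  \<comment> \<open>The primitive part \<open>\<alpha> + \<beta> a\<close> of the conjugate of \<open>g + h a\<close> is a common right factor of all
     elements \<open>C + D a\<close> whose product with \<open>g + h a\<close> lies in \<open>A\<close>.\<close>
  obtain c \<alpha> \<beta> where c: "\<sigma> g = c * \<alpha>" "- h = c * \<beta>" and \<alpha>\<beta>: "coprime_pair \<alpha> \<beta>"
    using primitive[of "\<sigma> g" "- h"] gh by auto
  have c0: "c \<noteq> 0" using c gh by auto
  have h: "h = - (c * \<beta>)" using c(2) by (metis minus_minus)
  have divide: "\<exists>d. C = d * \<alpha> \<and> D = d * \<beta>" if "D * \<sigma> g + C * h = 0" for C D
  proof -
    have "c * (D * \<alpha>) = c * (C * \<beta>)"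
      using that unfolding c(1) h by (simp add: algebra_simps)
    then have "D * \<alpha> = C * \<beta>" using c0 by simp
    then obtain d where "D = d * \<beta>" "C = d * \<alpha>" by (rule coprime_pairD[OF \<alpha>\<beta>])
    then show ?thesis by blast
  qed
  obtain R where R: "\<tau> r = R * \<alpha>" "\<tau> t = R * \<beta>" using divide[OF bot] by blast
  obtain S where S: "\<tau> (\<sigma> s) = S * \<alpha>" "\<tau> (\<sigma> m) = S * \<beta>" using divide[OF top] by blast
  define e where "e = \<iota> \<alpha> + \<iota> \<beta> * a"
  have "\<tau> R \<noteq> 0 \<or> \<tau> S \<noteq> 0"
  proof (rule ccontr)
    assume "\<not> ?thesis"
    then have "R = 0" "S = 0" by auto
    then show False using R S nontrivial by simp
  qed
  \<comment> \<open>The left factor \<open>\<tau>(R) + \<sigma>(\<tau>(S)) a\<close> is \<open>e1 k\<close> with \<open>e1 = \<gamma> + \<delta> a\<close> primitive; as \<open>k\<close> stands to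
     the right of \<open>a\<close>, the primitive pair is \<open>(\<gamma>, \<sigma>(\<delta>))\<close>.\<close>
  then obtain k \<gamma> \<delta>' where k: "\<tau> R = k * \<gamma>" "\<tau> S = k * \<delta>'" and cop: "coprime_pair \<gamma> \<delta>'"
    using primitive[of "\<tau> R" "\<tau> S"] by auto
  define \<delta> where "\<delta> = \<sigma> \<delta>'"
  have k0: "k \<noteq> 0" using k \<open>\<tau> R \<noteq> 0 \<or> \<tau> S \<noteq> 0\<close> by auto
  have cop\<sigma>: "coprime_pair (\<sigma> \<gamma>) \<delta>" using coprime_pair_\<sigma>[OF cop] by (simp add: \<delta>_def)
  define N where "N = \<gamma> * \<sigma> \<gamma> - x * (\<delta> * \<sigma> \<delta>)"
  have N0: "N \<noteq> 0"
    unfolding N_def using norm_x_nonzero coprime_pair_nonzero[OF cop] by (simp add: \<delta>_def)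
  define e1 where "e1 = \<iota> \<gamma> + \<iota> \<delta> * a"
  define e1' where "e1' = \<iota> (\<sigma> \<gamma>) - \<iota> \<delta> * a"
  have r: "r = k * \<gamma> * \<tau> \<alpha>" and t: "t = k * \<gamma> * \<tau> \<beta>"
    using arg_cong[OF R(1), of \<tau>] arg_cong[OF R(2), of \<tau>] k(1) by (simp_all add: push)
  have s: "s = \<sigma> k * \<delta> * \<sigma> (\<tau> \<alpha>)" and m: "m = \<sigma> k * \<delta> * \<sigma> (\<tau> \<beta>)"
    using arg_cong[OF S(1), of "\<lambda>z. \<sigma> (\<tau> z)"] arg_cong[OF S(2), of "\<lambda>z. \<sigma> (\<tau> z)"] arg_cong[OF k(2), of \<sigma>]
    by (simp_all add: \<sigma>_mult \<tau>_mult \<sigma>_\<tau> \<sigma>_inv \<tau>_inv \<delta>_def)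
  have u': "u = \<iota> p + \<iota> q * a + e1 * \<iota> k * b * e"
    unfolding u e1_def e_def r t s m by (simp add: push algebra_simps)
  define P where "P = \<sigma> \<gamma> * p - x * (\<delta> * \<sigma> q)"
  define Q where "Q = \<sigma> \<gamma> * q - \<delta> * \<sigma> p"
  define H where "H = N * k"
  have e1'e1: "e1' * e1 = \<iota> N" and e1e1': "e1 * e1' = \<iota> N"
    unfolding e1_def e1'_def N_def by (rule conj_mult mult_conj)+
  have "e1' * (\<iota> p + \<iota> q * a) = \<iota> P + \<iota> Q * a"
    unfolding P_def Q_def e1'_def by (simp add: push algebra_simps \<iota>_diff)
  moreover have "e1' * (e1 * \<iota> k * b * e) = \<iota> H * b * e"
    unfolding H_def \<iota>_mult e1'e1[symmetric] by (simp add: mult.assoc)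
  ultimately have E: "e1' * u = \<iota> P + \<iota> Q * a + \<iota> H * b * e"
    unfolding u' by (simp add: distrib_left mult.assoc)
  \<comment> \<open>The right-hand side of \<open>e1' u v = e1'\<close> has no component at index \<open>1 - K > 1\<close>, so \<open>P + Q a\<close>
     is divisible by \<open>e\<close> as well.\<close>
  have "Q * \<sigma> g + P * h = 0"
  proof (rule rel1)
    have "e1' * u * v = e1'" by (simp add: mult.assoc uv)
    moreover have "pr (1 - K) e1' = 0"
      using \<open>K < 0\<close> unfolding e1'_def by (simp add: pr_simps)
    ultimately have "pr (1 - K) ((\<iota> P + \<iota> Q * a + \<iota> H * b * e) * v) = 0"
      unfolding E by simp
    then show "\<iota> Q * (a * pr K v) + \<iota> P * pr (1 - K) v = 0"
      using K(1) by (simp add: e_def distrib_right distrib_left mult.assoc pr_simps K(2) algebra_simps)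
  qed
  then obtain \<kappa> where \<kappa>: "P = \<kappa> * \<alpha>" "Q = \<kappa> * \<beta>" using divide by blast
  have E': "e1' * u = (\<iota> \<kappa> + \<iota> H * b) * e"
    unfolding E \<kappa> e_def by (simp add: push algebra_simps)
  define U where "U = \<kappa> * \<tau> \<kappa> - y * (H * \<tau> H)"
  have H0: "H \<noteq> 0" using N0 k0 by (simp add: H_def)
  have U0: "U \<noteq> 0" unfolding U_def using norm_y_nonzero H0 by blast
  have \<tau>U: "\<tau> U = U" unfolding U_def by (simp add: \<tau>_diff \<tau>_mult \<tau>_inv \<tau>_y mult_ac)
  \<comment> \<open>Multiplying \<open>(\<kappa> + H b) T = e1'\<close> by the conjugate of \<open>\<kappa> + H b\<close> and comparing coefficients.\<close>
  define T where "T = e * v"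
  have "(\<iota> \<kappa> + \<iota> H * b) * T = e1'"
    unfolding T_def mult.assoc[symmetric] E'[symmetric] by (simp add: mult.assoc uv)
  then have "(\<iota> (\<tau> \<kappa>) - \<iota> H * b) * (\<iota> \<kappa> + \<iota> H * b) * T = (\<iota> (\<tau> \<kappa>) - \<iota> H * b) * e1'"
    by (simp add: mult.assoc)
  moreover have "(\<iota> (\<tau> \<kappa>) - \<iota> H * b) * (\<iota> \<kappa> + \<iota> H * b) = \<iota> U"
    unfolding U_def by (simp add: push algebra_simps \<iota>_diff)
  ultimately have UT: "\<iota> U * T = \<iota> (\<tau> \<kappa> * \<sigma> \<gamma>) + \<iota> (- \<tau> \<kappa> * \<delta>) * a
      + \<iota> (- H * \<tau> (\<sigma> \<gamma>)) * b + \<iota> (H * \<tau> \<delta>) * (b * a)"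
    unfolding e1'_def by (simp add: push algebra_simps \<iota>_minus)
  obtain T0 where T0: "pr 0 T = \<iota> T0" using layer_0 layer_pr by blast
  obtain T1 where T1: "pr 1 T = \<iota> T1 * a" using layer_1_coeff layer_pr by blast
  obtain T2 where T2: "pr (- 1) T = \<iota> T2 * b" using layer_m1_coeff layer_pr by blast
  obtain T3 where T3: "pr (- 2) T = \<iota> T3 * (b * a)" using layer_m2_coeff layer_pr by blast
  have "\<iota> (U * T0) = \<iota> (\<tau> \<kappa> * \<sigma> \<gamma>)"
    using arg_cong[OF UT, of "pr 0"] by (simp add: pr_simps T0 push)
  then have d0: "U dvd \<tau> \<kappa> * \<sigma> \<gamma>" by (metis \<iota>_inj dvd_triv_left)
  have "\<iota> (U * T1) * a = \<iota> (- \<tau> \<kappa> * \<delta>) * a"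
    using arg_cong[OF UT, of "pr 1"] by (simp add: pr_simps T1 push)
  then have d1: "U dvd \<tau> \<kappa> * \<delta>"
    by (metis \<iota>_inj dvd_triv_left mult_a_cancel(1) dvd_minus_iff mult_minus_left)
  have "\<iota> (U * T2) * b = \<iota> (- H * \<tau> (\<sigma> \<gamma>)) * b"
    using arg_cong[OF UT, of "pr (- 1)"] by (simp add: pr_simps T2 push)
  then have d2: "U dvd H * \<tau> (\<sigma> \<gamma>)"
    by (metis \<iota>_inj dvd_triv_left mult_b_cancel(1) dvd_minus_iff mult_minus_left)
  have "\<iota> (U * T3) * b * a = \<iota> (H * \<tau> \<delta>) * b * a"
    using arg_cong[OF UT, of "pr (- 2)"] by (simp add: pr_simps T3 push mult.assoc)
  then have d3: "U dvd H * \<tau> \<delta>"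
    by (metis \<iota>_inj dvd_triv_left mult_a_cancel(1) mult_b_cancel(1))
  obtain \<kappa>' where \<kappa>': "\<tau> \<kappa> = U * \<kappa>'"
    using coprime_pair_dvd[OF cop\<sigma> U0 d0 d1] by (elim dvdE)
  obtain H' where H': "H = U * H'"
    using coprime_pair_dvd[OF coprime_pair_\<tau>[OF cop\<sigma>] U0 d2 d3] by (elim dvdE)
  have \<kappa>2: "\<kappa> = U * \<tau> \<kappa>'" using arg_cong[OF \<kappa>', of \<tau>] by (simp add: \<tau>_mult \<tau>_inv \<tau>U)
  \<comment> \<open>\<open>U\<close> is quadratic in \<open>\<kappa>\<close> and \<open>H\<close>, both of which it divides.\<close>
  have "U = U * (U * (\<kappa>' * \<tau> \<kappa>' - y * (H' * \<tau> H')))"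
    by (subst U_def, subst \<kappa>', subst \<kappa>2, subst (1) H', subst H')
       (simp add: \<tau>_mult \<tau>U algebra_simps)
  then have "U dvd 1" using U0 by (metis mult_cancel_left1 dvd_triv_left)
  then have "\<kappa> = 0" using norm_y[of \<kappa> H] H0 unfolding U_def by blast
  have "y * \<tau> H * H dvd 1" using \<open>U dvd 1\<close> unfolding U_def \<open>\<kappa> = 0\<close> by (simp add: mult_ac)
  then have Hu: "H dvd 1" by (rule dvd_mult_right)
  then have Nu: "N dvd 1" unfolding H_def by (rule dvd_mult_left)
  have m1: "monomial e1" unfolding e1_def using Nu unfolding N_def by (rule monomial_norm_unit)
  have mH: "monomial (\<iota> H * b)" using Hu monomial.intros by blast
  have fac: "\<iota> N * u = e1 * (\<iota> H * b) * e"
    using arg_cong[OF E', of "\<lambda>z. e1 * z"] \<open>\<kappa> = 0\<close> by (simp add: e1e1' flip: mult.assoc)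
  have "monomial (e1 * (\<iota> H * b))" using m1 mH by (rule monomial.mult)
  then obtain z where z: "z * (e1 * (\<iota> H * b)) = 1" "(e1 * (\<iota> H * b)) * z = 1"
    using monomial_invertible by blast
  obtain N' where N': "N * N' = 1" using Nu by (metis dvdE)
  have "e = z * (\<iota> N * u)" unfolding fac using z by (simp flip: mult.assoc)
  then have "e * (v * (\<iota> N' * (e1 * (\<iota> H * b)))) = z * \<iota> N * (u * v) * \<iota> N' * (e1 * (\<iota> H * b))"
    by (simp add: mult.assoc)
  also have "\<dots> = z * \<iota> (N * N') * (e1 * (\<iota> H * b))" by (simp add: uv \<iota>_mult mult.assoc)
  also have "\<dots> = 1" using z N' by (simp add: \<iota>_one)
  finally have me: "monomial e" unfolding e_def by (rule monomial_of_right_inverse)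
  have "u = \<iota> N' * (\<iota> N * u)" using N' by (simp add: \<iota>_mult' mult.commute \<iota>_one)
  also have "\<dots> = \<iota> N' * (e1 * (\<iota> H * b) * e)" by (simp only: fac)
  finally have "u = \<iota> N' * (e1 * (\<iota> H * b) * e)" .
  moreover have "N' dvd 1" using N' by (metis dvd_triv_right)
  then have "monomial (\<iota> N' * (e1 * (\<iota> H * b) * e))"
    by (intro monomial.mult[OF monomial.scalar monomial.mult[OF monomial.mult[OF m1 mH] me]])
  ultimately show ?thesis by (rule ssubst)
qed

text \<open>
  Exchanging \<open>a\<close> and \<open>b\<close>.
\<close>

lemma swapped:
  "dihedral_crossed \<iota> \<tau> \<sigma> y x b a (\<lambda>k. layer (- k)) (\<lambda>k. pr (- k))"
proof
  show "layer (- (k + parity_sign k * l)) (s * t)" if "layer (- k) s" "layer (- l) t" for k l s t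
    using layer_mult[OF that] by (simp split: if_splits add: algebra_simps)
  show "pr (- j) (s * v) = s * pr (- (parity_sign k * (j - k))) v" if "layer (- k) s" for k s j v
    using pr_mult[OF that, of "- j" v] by (simp add: algebra_simps)
  show "v = 0" if "\<And>k. pr (- k) v = 0" for v
    using that pr_zeroD by (metis minus_minus)
  show "finite {k. pr (- k) v \<noteq> 0}" for v
    using finite_vimageI[OF finite_pr, of uminus v] by (simp add: vimage_def)
  show "\<tau> (\<sigma> f) = \<sigma> (\<tau> f)" for f by (simp add: \<sigma>_\<tau>)
  show "layer (- 0) (\<iota> f)" for f by (simp add: layer_\<iota>)
  show "layer (- 1) b" by (rule layer_b)
  show "layer (- (- 1)) a" by (simp add: layer_a)
  show "\<exists>f. s = \<iota> f" if "layer (- 0) s" for s using layer_0 that by simp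
  show "pr (- j) s = 0" if "layer (- k) s" "j \<noteq> k" for j k s
    using pr_other[OF that(1), of "- j"] that(2) by simp
qed (rule \<iota>_add \<iota>_mult \<iota>_one \<sigma>_add \<sigma>_mult \<sigma>_inv \<tau>_add \<tau>_mult \<tau>_inv a_\<iota> b_\<iota> a_a b_b \<sigma>_x \<tau>_y
   x_unit y_unit layer_basis layer_pr pr_same pr_add norm_x norm_y primitive \<iota>_zeroD | assumption)+

end

section \<open>Integral group rings and homomorphisms\<close>

text \<open>
  With the lexicographic order, \<open>\<int>\<^sup>2\<close> is an ordered group, which makes the ring of Laurent
  polynomials in two variables a domain.
\<close>

instance prod :: (linordered_ab_group_add, linordered_ab_group_add) ordered_cancel_comm_monoid_add
  by standard (auto simp: less_eq_prod_def)

text \<open>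
  Laurent polynomials over the integers in two variables, as the group ring of \<open>\<int>\<^sup>2\<close>: the monomial
  \<open>x\<^sup>i y\<^sup>j\<close> is \<open>frag_of (i, j)\<close>.
\<close>

type_synonym laurent = "(int \<times> int) \<Rightarrow>\<^sub>0 int"

lemma frag_of_mult: "frag_of g * frag_of h = frag_of (g + h)"
  by (simp add: mult_single)

text \<open>
  The linear extension of a map \<open>\<theta>\<close> of basis elements; it is a ring homomorphism if \<open>\<theta>\<close> is additive.
\<close>

definition pushforward :: "('a \<Rightarrow> 'b) \<Rightarrow> ('a \<Rightarrow>\<^sub>0 int) \<Rightarrow> ('b \<Rightarrow>\<^sub>0 int)" where
  "pushforward \<theta> = frag_extend (\<lambda>m. frag_of (\<theta> m))"

lemma pushforward_simps [simp]:
  "pushforward \<theta> 0 = 0"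
  "pushforward \<theta> (frag_of m) = frag_of (\<theta> m)"
  "pushforward \<theta> (f + g) = pushforward \<theta> f + pushforward \<theta> g"
  "pushforward \<theta> (f - g) = pushforward \<theta> f - pushforward \<theta> g"
  by (simp_all add: pushforward_def frag_extend_add frag_extend_diff)

lemma poly_mapping_int_induct [case_names zero frag_of diff]:
  fixes f :: "'a \<Rightarrow>\<^sub>0 int"
  assumes "P 0" "\<And>m. P (frag_of m)" "\<And>f g. P f \<Longrightarrow> P g \<Longrightarrow> P (f - g)"
  shows "P f"
  using frag_induction[of f UNIV P] assms by simp

lemma pushforward_mult:
  assumes "\<And>m n. \<theta> (m + n) = \<theta> m + \<theta> n"
  shows "pushforward \<theta> (f * g) = pushforward \<theta> f * pushforward \<theta> g"
proof (induction f rule: poly_mapping_int_induct)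
  case (frag_of m)
  show ?case
    by (induction g rule: poly_mapping_int_induct) (simp_all add: frag_of_mult assms right_diff_distrib)
qed (simp_all add: left_diff_distrib)

lemma pushforward_pushforward: "pushforward \<theta> (pushforward \<eta> f) = pushforward (\<lambda>m. \<theta> (\<eta> m)) f"
  by (induction f rule: poly_mapping_int_induct) simp_all

lemma pushforward_id: "pushforward (\<lambda>m. m) f = f"
  by (induction f rule: poly_mapping_int_induct) simp_all

lemma lookup_pushforward:
  assumes "inj \<theta>"
  shows "Poly_Mapping.lookup (pushforward \<theta> f) (\<theta> m) = Poly_Mapping.lookup f m"
  by (induction f rule: poly_mapping_int_induct)
     (simp_all add: lookup_minus inj_eq[OF assms])

lemma keys_pushforward: "Poly_Mapping.keys (pushforward \<theta> f) \<subseteq> \<theta> ` Poly_Mapping.keys f"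
proof -
  have "Poly_Mapping.keys (pushforward \<theta> f) \<subseteq> (\<Union>m\<in>Poly_Mapping.keys f. Poly_Mapping.keys (frag_of (\<theta> m)))"
    unfolding pushforward_def by (rule keys_frag_extend)
  then show ?thesis by (auto simp: keys_frag_of)
qed

lemma pushforward_intertwine:
  assumes "\<And>m. g + \<theta> m = \<theta> (\<eta> m) + g"
  shows "frag_of g * pushforward \<theta> f = pushforward \<theta> (pushforward \<eta> f) * frag_of g"
  by (induction f rule: poly_mapping_int_induct)
     (simp_all add: frag_of_mult assms left_diff_distrib right_diff_distrib)

text \<open>
  The restriction of \<open>f\<close> to the basis elements that satisfy \<open>P\<close>.
\<close>

definition part :: "('a \<Rightarrow> bool) \<Rightarrow> ('a \<Rightarrow>\<^sub>0 'b) \<Rightarrow> ('a \<Rightarrow>\<^sub>0 'b::comm_monoid_add)" where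
  "part P f = Poly_Mapping.mapp (\<lambda>k c. if P k then c else 0) f"

lemma lookup_part: "Poly_Mapping.lookup (part P f) k = (if P k then Poly_Mapping.lookup f k else 0)"
  by (auto simp: part_def lookup_mapp in_keys_iff when_def)

lemma keys_part: "Poly_Mapping.keys (part P f) = {k \<in> Poly_Mapping.keys f. P k}"
  by (auto simp: in_keys_iff lookup_part split: if_splits)

lemma part_frag_of: "part P (frag_of g) = (if P g then frag_of g else 0)"
  by (auto intro!: poly_mapping_eqI simp: lookup_part lookup_single when_def)

lemma part_add: "part P (f + g) = part P f + part P g"
  by (rule poly_mapping_eqI) (simp add: lookup_part lookup_add)

lemma part_diff: "part P (f - g) = part P f - part P (g :: _ \<Rightarrow>\<^sub>0 int)"
  by (rule poly_mapping_eqI) (simp add: lookup_part lookup_minus)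

lemma part_0: "part P 0 = 0"
  by (rule poly_mapping_eqI) (simp add: lookup_part)

section \<open>Degrees and units of Laurent polynomials\<close>

text \<open>
  The degree with respect to a weight \<open>d\<close> of the monomials. The least weight that occurs is minus
  the degree with respect to \<open>-d\<close>. The value at \<open>0\<close> is irrelevant.
\<close>

definition deg :: "(int \<times> int \<Rightarrow> int) \<Rightarrow> laurent \<Rightarrow> int" where
  "deg d f = Max (d ` Poly_Mapping.keys f)"

lemma deg_ge: "k \<in> Poly_Mapping.keys f \<Longrightarrow> d k \<le> deg d f"
  by (simp add: deg_def)

lemma deg_attained: "f \<noteq> 0 \<Longrightarrow> \<exists>k\<in>Poly_Mapping.keys f. d k = deg d f"
  using Max_in[of "d ` Poly_Mapping.keys f"] unfolding deg_def by fastforce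

lemma deg_eqI: "k \<in> Poly_Mapping.keys f \<Longrightarrow> d k = n \<Longrightarrow> (\<And>k. k \<in> Poly_Mapping.keys f \<Longrightarrow> d k \<le> n) \<Longrightarrow> deg d f = n"
  unfolding deg_def by (intro Max_eqI) auto

lemma deg_mult:
  assumes d: "\<And>k l. d (k + l) = d k + d l" and "f \<noteq> 0" "g \<noteq> 0"
  shows "deg d (f * g) = deg d f + deg d g"
proof -
  define f1 where "f1 = part (\<lambda>k. d k = deg d f) f"
  define f2 where "f2 = part (\<lambda>k. d k \<noteq> deg d f) f"
  define g1 where "g1 = part (\<lambda>k. d k = deg d g) g"
  define g2 where "g2 = part (\<lambda>k. d k \<noteq> deg d g) g"
  have fg: "f = f1 + f2" "g = g1 + g2"
    by (auto intro!: poly_mapping_eqI simp: lookup_add lookup_part f1_def f2_def g1_def g2_def)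
  have keys1: "d k = deg d f" if "k \<in> Poly_Mapping.keys f1" for k
    using that by (simp add: keys_part f1_def)
  have keys2: "d k = deg d g" if "k \<in> Poly_Mapping.keys g1" for k
    using that by (simp add: keys_part g1_def)
  have keys3: "d k < deg d f" if "k \<in> Poly_Mapping.keys f2" for k
    using that deg_ge[of k f d] by (simp add: keys_part f2_def)
  have keys4: "d k < deg d g" if "k \<in> Poly_Mapping.keys g2" for k
    using that deg_ge[of k g d] by (simp add: keys_part g2_def)
  have "f1 \<noteq> 0" "g1 \<noteq> 0"
    using deg_attained[of f d] deg_attained[of g d] assms(2,3)
    by (auto simp flip: keys_eq_empty simp: keys_part f1_def g1_def)
  then have "f1 * g1 \<noteq> 0" by simp
  then obtain k where k: "k \<in> Poly_Mapping.keys (f1 * g1)" using keys_eq_empty by blast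
  then obtain k1 k2 where "k = k1 + k2" "k1 \<in> Poly_Mapping.keys f1" "k2 \<in> Poly_Mapping.keys g1"
    using keys_mult[of f1 g1] by blast
  then have dk: "d k = deg d f + deg d g" using keys1 keys2 by (simp add: d)
  have low: "k \<notin> Poly_Mapping.keys (f' * g')"
    if "\<And>i j. i \<in> Poly_Mapping.keys f' \<Longrightarrow> j \<in> Poly_Mapping.keys g' \<Longrightarrow> d i + d j < deg d f + deg d g" for f' g'
  proof
    assume "k \<in> Poly_Mapping.keys (f' * g')"
    then obtain i j where "k = i + j" "i \<in> Poly_Mapping.keys f'" "j \<in> Poly_Mapping.keys g'"
      using keys_mult[of f' g'] by blast
    then show False using that[of i j] dk d[of i j] by simp
  qed
  have "k \<notin> Poly_Mapping.keys (f1 * g2)" "k \<notin> Poly_Mapping.keys (f2 * g1)" "k \<notin> Poly_Mapping.keys (f2 * g2)"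
    by (rule low; use keys1 keys2 keys3 keys4 in \<open>simp add: add_strict_mono\<close>)+
  then have "Poly_Mapping.lookup (f * g) k = Poly_Mapping.lookup (f1 * g1) k"
    by (simp add: fg distrib_left distrib_right lookup_add in_keys_iff)
  then have "k \<in> Poly_Mapping.keys (f * g)" using k by (simp add: in_keys_iff)
  then show ?thesis
  proof (rule deg_eqI)
    show "d j \<le> deg d f + deg d g" if "j \<in> Poly_Mapping.keys (f * g)" for j
    proof -
      obtain i i' where "j = i + i'" "i \<in> Poly_Mapping.keys f" "i' \<in> Poly_Mapping.keys g"
        using \<open>j \<in> _\<close> keys_mult[of f g] by blast
      then show ?thesis using deg_ge[of i f d] deg_ge[of i' g d] by (simp add: d)
    qed
  qed (rule dk)
qed

lemma deg_frag_of: "deg d (frag_of k) = d k"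
  by (simp add: deg_def keys_frag_of)

lemma deg_1: "deg d 1 = d 0"
  by (simp add: deg_def)

lemma deg_diff:
  assumes "f \<noteq> 0" "g \<noteq> 0" "deg d f \<noteq> deg d g"
  shows "f - g \<noteq> 0" "deg d (f - g) = max (deg d f) (deg d g)"
proof -
  obtain k where k: "k \<in> Poly_Mapping.keys (f - g)" "d k = max (deg d f) (deg d g)"
  proof (cases "deg d f < deg d g")
    case True
    obtain k where k: "k \<in> Poly_Mapping.keys g" "d k = deg d g" using deg_attained[OF assms(2)] by blast
    then have "k \<notin> Poly_Mapping.keys f" using deg_ge[of k f d] True by auto
    then show ?thesis using k True that[of k] by (simp add: in_keys_iff lookup_minus)
  next
    case False
    obtain k where k: "k \<in> Poly_Mapping.keys f" "d k = deg d f" using deg_attained[OF assms(1)] by blast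
    then have "k \<notin> Poly_Mapping.keys g" using deg_ge[of k g d] False assms(3) by auto
    then show ?thesis using k False that[of k] by (simp add: in_keys_iff lookup_minus)
  qed
  then show "f - g \<noteq> 0" by auto
  show "deg d (f - g) = max (deg d f) (deg d g)"
    using k
  proof (rule deg_eqI)
    show "d j \<le> max (deg d f) (deg d g)" if "j \<in> Poly_Mapping.keys (f - g)" for j
    proof -
      have "j \<in> Poly_Mapping.keys f \<or> j \<in> Poly_Mapping.keys g" using that keys_diff[of f g] by blast
      then show ?thesis using deg_ge[of j f d] deg_ge[of j g d] by (auto simp: le_max_iff_disj)
    qed
  qed
qed

lemma deg_pushforward:
  assumes "\<And>k. d (\<theta> k) = d k" "inj \<theta>" "f \<noteq> 0"
  shows "deg d (pushforward \<theta> f) = deg d f"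
proof -
  have keys: "Poly_Mapping.keys (pushforward \<theta> f) = \<theta> ` Poly_Mapping.keys f"
    using keys_pushforward[of \<theta> f] by (auto simp: in_keys_iff lookup_pushforward[OF assms(2)])
  show ?thesis unfolding deg_def keys image_image assms(1) ..
qed

text \<open>
  The least weight of a monomial is at most the largest one.
\<close>

lemma deg_low_le:
  assumes "f \<noteq> 0" shows "- deg (\<lambda>k. - d k) f \<le> deg d f"
proof -
  obtain k where "k \<in> Poly_Mapping.keys f" using assms keys_eq_empty by blast
  then show ?thesis using deg_ge[of k f d] deg_ge[of k f "\<lambda>k. - d k"] by simp
qed

text \<open>
  A unit is homogeneous for every additive weight.
\<close>

lemma deg_unit:
  assumes d: "\<And>k l. d (k + l) = d k + d l" and f: "f dvd 1"
  shows "deg d f = - deg (\<lambda>k. - d k) f"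
proof -
  obtain g where g: "f * g = 1" using f by (metis dvdE)
  then have nz: "f \<noteq> 0" "g \<noteq> 0" by auto
  have "d 0 = 0" using d[of 0 0] by simp
  then have "deg d f + deg d g = 0"
    using deg_mult[OF d nz] by (simp add: g deg_1)
  moreover have "deg (\<lambda>k. - d k) f + deg (\<lambda>k. - d k) g = 0"
    using deg_mult[of "\<lambda>k. - d k", OF _ nz] \<open>d 0 = 0\<close> by (simp add: g deg_1 d)
  ultimately show ?thesis using deg_low_le[OF nz(1), of d] deg_low_le[OF nz(2), of d] by linarith
qed

lemma laurent_unit:
  fixes f :: laurent
  assumes "f dvd 1"
  obtains m where "f = frag_of m \<or> f = - frag_of m"
proof -
  obtain g where g: "f * g = 1" using assms by (metis dvdE)
  have const: "d k = deg d f" if "k \<in> Poly_Mapping.keys f" "\<And>k l. d (k + l) = d k + d l" for d k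
    using deg_unit[OF that(2) assms] deg_ge[OF that(1), of d] deg_ge[OF that(1), of "\<lambda>k. - d k"] by simp
  define m where "m = (deg fst f, deg snd f)"
  have "Poly_Mapping.keys f \<subseteq> {m}"
    using const[of _ fst] const[of _ snd] by (auto simp: m_def)
  then have f: "f = Poly_Mapping.single m (Poly_Mapping.lookup f m)"
    by (intro poly_mapping_eqI) (auto simp: lookup_single when_def in_keys_iff)
  have "Poly_Mapping.lookup (f * g) 0 = 1" by (simp add: g)
  have "Poly_Mapping.lookup f m dvd 1"
  proof -
    have "Poly_Mapping.lookup f m dvd Poly_Mapping.lookup (Poly_Mapping.single m (Poly_Mapping.lookup f m) * h) j" for h :: laurent and j
    proof (induction h arbitrary: j rule: poly_mapping_int_induct)
      case (frag_of n)
      then show ?case by (simp add: mult_single lookup_single when_def)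
    qed (simp_all add: right_diff_distrib lookup_minus)
    from this[of g 0] show ?thesis using \<open>Poly_Mapping.lookup (f * g) 0 = 1\<close> f by simp
  qed
  then have "Poly_Mapping.lookup f m = 1 \<or> Poly_Mapping.lookup f m = -1"
    by (auto simp: abs_if split: if_splits)
  then show ?thesis
    using that[of m] f by (metis single_uminus)
qed

text \<open>
  The two summands have degrees of different parity, so the difference is neither zero nor
  homogeneous.
\<close>

lemma norm_not_unit:
  fixes f g z :: laurent and d :: "int \<times> int \<Rightarrow> int"
  assumes d: "\<And>k l. d (k + l) = d k + d l"
    and \<theta>: "inj \<theta>" "\<And>k. d (\<theta> k) = d k" and z: "d z' = 1" "z = frag_of z'"
    and nz: "f \<noteq> 0" "g \<noteq> 0"
  shows "f * pushforward \<theta> f - z * (g * pushforward \<theta> g) \<noteq> 0 \<and>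
    \<not> f * pushforward \<theta> f - z * (g * pushforward \<theta> g) dvd 1"
proof -
  have push: "pushforward \<theta> h \<noteq> 0" if "h \<noteq> 0" for h
    using that keys_eq_empty[of h] lookup_pushforward[OF \<theta>(1), of h] by (metis lookup_zero poly_mapping_eqI)
  define A B where "A = f * pushforward \<theta> f" and "B = z * (g * pushforward \<theta> g)"
  have "z \<noteq> 0" using z by simp
  then have AB: "A \<noteq> 0" "B \<noteq> 0" unfolding A_def B_def using nz push by simp_all
  have deg: "deg e A = 2 * deg e f" "deg e B = e z' + 2 * deg e g"
    if "\<And>k l. e (k + l) = e k + e l" "\<And>k. e (\<theta> k) = e k" for e
    unfolding A_def B_def
    using nz push \<open>z \<noteq> 0\<close> by (simp_all add: deg_mult[OF that(1)] deg_pushforward[of e \<theta>, OF that(2) \<theta>(1)] z(2) deg_frag_of)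
  note top = deg[of d, OF d \<theta>(2), simplified z]
  have low: "deg (\<lambda>k. - d k) A = 2 * deg (\<lambda>k. - d k) f" "deg (\<lambda>k. - d k) B = - 1 + 2 * deg (\<lambda>k. - d k) g"
    using deg[of "\<lambda>k. - d k"] by (simp_all add: d \<theta>(2) z)
  have neq: "deg d A \<noteq> deg d B" "deg (\<lambda>k. - d k) A \<noteq> deg (\<lambda>k. - d k) B"
    unfolding top low by presburger+
  have "\<not> A - B dvd 1"
  proof
    assume "A - B dvd 1"
    then have "deg d (A - B) = - deg (\<lambda>k. - d k) (A - B)" by (rule deg_unit[OF d])
    then show False
      using neq deg_low_le[OF AB(1), of d] deg_low_le[OF AB(2), of d]
      by (simp add: deg_diff(2)[OF AB] max_def split: if_splits)
  qed
  then show ?thesis using deg_diff(1)[OF AB neq(1)] unfolding A_def B_def by simp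
qed

section \<open>Primitive parts of pairs of Laurent polynomials\<close>

abbreviation laurent_x :: laurent where "laurent_x \<equiv> frag_of (1, 0)"
abbreviation laurent_y :: laurent where "laurent_y \<equiv> frag_of (0, 1)"

text \<open>
  The inclusion of \<open>\<int>[x]\<close>, and then that of \<open>\<int>[x][y]\<close>.
\<close>

definition laurent_of_poly :: "int poly \<Rightarrow> laurent" where
  "laurent_of_poly p = poly (map_poly of_int p) laurent_x"

definition laurent_of_poly2 :: "int poly poly \<Rightarrow> laurent" where
  "laurent_of_poly2 F = poly (map_poly laurent_of_poly F) laurent_y"

lemma laurent_of_poly_simps [simp]:
  "laurent_of_poly 0 = 0"
  "laurent_of_poly (pCons c p) = of_int c + laurent_x * laurent_of_poly p"
  by (simp_all add: laurent_of_poly_def map_poly_pCons)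

lemma laurent_of_poly_add [simp]: "laurent_of_poly (p + q) = laurent_of_poly p + laurent_of_poly q"
  by (induction p q rule: poly_induct2) (simp_all add: algebra_simps)

lemma laurent_of_poly_smult [simp]: "laurent_of_poly (smult c p) = of_int c * laurent_of_poly p"
  by (induction p) (simp_all add: algebra_simps)

lemma laurent_of_poly_mult [simp]: "laurent_of_poly (p * q) = laurent_of_poly p * laurent_of_poly q"
  by (induction p) (simp_all add: algebra_simps)

lemma laurent_of_poly2_simps [simp]:
  "laurent_of_poly2 0 = 0"
  "laurent_of_poly2 (pCons p F) = laurent_of_poly p + laurent_y * laurent_of_poly2 F"
  by (simp_all add: laurent_of_poly2_def map_poly_pCons)

lemma laurent_of_poly2_add [simp]: "laurent_of_poly2 (F + G) = laurent_of_poly2 F + laurent_of_poly2 G"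
  by (induction F G rule: poly_induct2) (simp_all add: algebra_simps)

lemma laurent_of_poly2_smult [simp]: "laurent_of_poly2 (smult p F) = laurent_of_poly p * laurent_of_poly2 F"
  by (induction F) (simp_all add: algebra_simps)

lemma laurent_of_poly2_mult [simp]: "laurent_of_poly2 (F * G) = laurent_of_poly2 F * laurent_of_poly2 G"
  by (induction F) (simp_all add: algebra_simps)

lemma laurent_of_poly2_minus [simp]: "laurent_of_poly2 (F - G) = laurent_of_poly2 F - laurent_of_poly2 G"
  using laurent_of_poly2_add[of "F - G" G] by (simp add: algebra_simps)

lemma lookup_monomial_mult: "Poly_Mapping.lookup (frag_of m * f) k = Poly_Mapping.lookup f (k - m)"
  for f :: laurent
  by (induction f rule: poly_mapping_int_induct)
     (auto simp: right_diff_distrib lookup_minus mult_single lookup_single when_def algebra_simps)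

lemma lookup_laurent_of_poly:
  "Poly_Mapping.lookup (laurent_of_poly p) (i, j) = (if 0 \<le> i \<and> j = 0 then coeff p (nat i) else 0)"
proof (induction p arbitrary: i)
  case (pCons c p)
  have "Poly_Mapping.lookup (of_int c :: laurent) (i, j) = (if i = 0 \<and> j = 0 then c else 0)"
    by (auto simp: lookup_of_int when_def zero_prod_def)
  moreover have "nat i = Suc (nat (i - 1))" if "0 < i" using that by simp
  ultimately show ?case
    using pCons by (cases "i > 0") (auto simp: lookup_add lookup_monomial_mult coeff_pCons split: nat.splits)
qed simp

lemma lookup_laurent_of_poly2:
  "Poly_Mapping.lookup (laurent_of_poly2 F) (i, j) =
    (if 0 \<le> i \<and> 0 \<le> j then coeff (coeff F (nat j)) (nat i) else 0)"
proof (induction F arbitrary: j)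
  case (pCons p F)
  have "nat j = Suc (nat (j - 1))" if "0 < j" using that by simp
  then show ?case
    using pCons by (cases "j > 0") (auto simp: lookup_add lookup_monomial_mult lookup_laurent_of_poly coeff_pCons split: nat.splits)
qed simp

lemma laurent_of_poly2_inj:
  assumes "laurent_of_poly2 F = laurent_of_poly2 G" shows "F = G"
proof (intro poly_eqI)
  fix i j
  show "coeff (coeff F j) i = coeff (coeff G j) i"
    using arg_cong[OF assms, of "\<lambda>f. Poly_Mapping.lookup f (int i, int j)"]
    by (simp add: lookup_laurent_of_poly2)
qed

lemma frag_of_unit: "frag_of m dvd (1 :: laurent)"
proof -
  have "frag_of m * frag_of (- m) = (1 :: laurent)" by (simp add: frag_of_mult flip: zero_prod_def)
  then show ?thesis by (metis dvd_triv_left)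
qed

lemma laurent_x_power: "laurent_x ^ n = frag_of (int n, 0)"
  by (induction n) (simp_all add: frag_of_mult flip: zero_prod_def)

lemma laurent_y_power: "laurent_y ^ n = frag_of (0, int n)"
  by (induction n) (simp_all add: frag_of_mult flip: zero_prod_def)

lemma laurent_of_poly2_x: "laurent_of_poly2 ([:[:0, 1:]:] ^ n) = laurent_x ^ n"
  by (induction n) (simp_all add: one_pCons)

lemma laurent_of_poly2_y: "laurent_of_poly2 ([:0, 1:] ^ n) = laurent_y ^ n"
  by (induction n) (simp_all add: one_pCons)

text \<open>
  Up to a monomial factor, every Laurent polynomial is a polynomial.
\<close>

lemma clear_denominators:
  "\<exists>F n. frag_of (int n, int n) * f = laurent_of_poly2 F"
proof (induction f rule: poly_mapping_int_induct)
  case zero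
  show ?case by (intro exI[of _ 0]) simp
next
  case (frag_of m)
  obtain i j where m: "m = (i, j)" by fastforce
  define n where "n = nat (\<bar>i\<bar> + \<bar>j\<bar>)"
  have n: "0 \<le> int n + i" "0 \<le> int n + j" by (simp_all add: n_def)
  have "laurent_of_poly2 ([:[:0, 1:]:] ^ nat (int n + i) * [:0, 1:] ^ nat (int n + j)) = frag_of (int n, int n) * frag_of m"
    by (simp only: laurent_of_poly2_mult laurent_of_poly2_x laurent_of_poly2_y laurent_x_power laurent_y_power)
       (simp add: frag_of_mult m n)
  then show ?case by metis
next
  case (diff f g)
  then obtain F G n k where F: "frag_of (int n, int n) * f = laurent_of_poly2 F"
    and G: "frag_of (int k, int k) * g = laurent_of_poly2 G" by blast
  have sh: "laurent_of_poly2 (([:[:0, 1:]:] ^ l * [:0, 1:] ^ l) * H) = frag_of (int l, int l) * laurent_of_poly2 H" for l H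
    by (simp only: laurent_of_poly2_mult laurent_of_poly2_x laurent_of_poly2_y laurent_x_power laurent_y_power)
       (simp add: frag_of_mult)
  have "frag_of (int (n + k), int (n + k)) * (f - g) =
      frag_of (int k, int k) * (frag_of (int n, int n) * f) - frag_of (int n, int n) * (frag_of (int k, int k) * g)"
    by (simp add: right_diff_distrib frag_of_mult add.commute flip: mult.assoc)
  also have "\<dots> = laurent_of_poly2 (([:[:0, 1:]:] ^ k * [:0, 1:] ^ k) * F - ([:[:0, 1:]:] ^ n * [:0, 1:] ^ n) * G)"
    unfolding F G by (simp only: sh laurent_of_poly2_minus)
  finally show ?case by blast
qed

lemma clear_denominators_pair:
  "\<exists>F G u. u dvd 1 \<and> u * f = laurent_of_poly2 F \<and> u * g = laurent_of_poly2 G"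
proof -
  obtain F n G k where F: "frag_of (int n, int n) * f = laurent_of_poly2 F"
    and G: "frag_of (int k, int k) * g = laurent_of_poly2 G" using clear_denominators by metis
  have sh: "laurent_of_poly2 (([:[:0, 1:]:] ^ l * [:0, 1:] ^ l) * H) = frag_of (int l, int l) * laurent_of_poly2 H" for l H
    by (simp only: laurent_of_poly2_mult laurent_of_poly2_x laurent_of_poly2_y laurent_x_power laurent_y_power)
       (simp add: frag_of_mult)
  have "frag_of (int n, int n) * frag_of (int k, int k) dvd (1 :: laurent)"
    using frag_of_unit by (simp add: frag_of_mult)
  moreover have "frag_of (int n, int n) * frag_of (int k, int k) * f = laurent_of_poly2 (([:[:0, 1:]:] ^ k * [:0, 1:] ^ k) * F)"
    unfolding sh F[symmetric] by (simp only: mult_ac)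
  moreover have "frag_of (int n, int n) * frag_of (int k, int k) * g = laurent_of_poly2 (([:[:0, 1:]:] ^ n * [:0, 1:] ^ n) * G)"
    unfolding sh G[symmetric] by (simp only: mult_ac)
  ultimately show ?thesis by blast
qed

text \<open>
  The greatest common divisor is taken in \<open>\<int>[x][y]\<close>, after clearing denominators.
\<close>

lemma laurent_primitive:
  fixes f g :: laurent
  assumes "f \<noteq> 0 \<or> g \<noteq> 0"
  shows "\<exists>c f' g'. f = c * f' \<and> g = c * g' \<and> coprime_pair f' g'"
proof -
  obtain F G u where u: "u dvd 1" and F: "u * f = laurent_of_poly2 F" and G: "u * g = laurent_of_poly2 G"
    using clear_denominators_pair by blast
  obtain u' where u': "u' * u = 1" using u by (metis dvdE mult.commute)
  have FG: "F \<noteq> 0 \<or> G \<noteq> 0"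
  proof (rule ccontr)
    assume "\<not> ?thesis"
    then have "u * f = 0 \<and> u * g = 0" using F G by simp
    then show False using assms u' by auto
  qed
  then obtain F' G' where F': "F = F' * gcd F G" and G': "G = G' * gcd F G" and cop: "coprime F' G'"
    using gcd_coprime_exists[of F G] by auto
  have cp: "coprime_pair (laurent_of_poly2 F') (laurent_of_poly2 G')"
    unfolding coprime_pair_def
  proof (intro allI impI)
    fix h k assume hk: "h * laurent_of_poly2 F' = k * laurent_of_poly2 G'"
    obtain H K w where w: "w dvd 1" and H: "w * h = laurent_of_poly2 H" and K: "w * k = laurent_of_poly2 K"
      using clear_denominators_pair by blast
    obtain w' where w': "w' * w = 1" using w by (metis dvdE mult.commute)
    have "laurent_of_poly2 (H * F') = laurent_of_poly2 (K * G')"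
      using hk by (simp add: mult.assoc flip: H K)
    then have HK: "H * F' = K * G'" by (rule laurent_of_poly2_inj)
    obtain D where D: "H = D * G'" "K = D * F'"
      \<comment> \<open>If \<open>G' = 0\<close>, coprimality makes \<open>F'\<close> a unit, and \<open>K / F'\<close> is the required factor.\<close>
    proof (cases "G' = 0")
      case True
      then have "F' dvd 1" using cop by simp
      then obtain E where E: "F' * E = 1" by (metis dvdE)
      have "F' \<noteq> 0" using E by auto
      then have "H = 0" using HK True by simp
      moreover have "K = K * E * F'" using E by (simp add: mult_ac)
      ultimately show ?thesis using that[of "K * E"] True by simp
    next
      case False
      have "G' dvd H * F'" by (simp add: HK)
      then have "G' dvd H" using cop by (simp add: coprime_commute coprime_dvd_mult_left_iff)
      then obtain D where D: "H = D * G'" by (metis dvdE mult.commute)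
      then have "K = D * F'" using HK False by (simp add: mult_ac)
      then show ?thesis using that D by blast
    qed
    have "h = w' * (w * h)" "k = w' * (w * k)" using w' by (simp_all flip: mult.assoc)
    then have "h = w' * laurent_of_poly2 D * laurent_of_poly2 G'" "k = w' * laurent_of_poly2 D * laurent_of_poly2 F'"
      unfolding H K D by (simp_all add: mult.assoc)
    then show "\<exists>d. h = d * laurent_of_poly2 G' \<and> k = d * laurent_of_poly2 F'" by blast
  qed
  have "f = u' * (u * f)" "g = u' * (u * g)" using u' by (simp_all flip: mult.assoc)
  moreover have "laurent_of_poly2 F = laurent_of_poly2 F' * laurent_of_poly2 (gcd F G)"
    "laurent_of_poly2 G = laurent_of_poly2 G' * laurent_of_poly2 (gcd F G)"
    using arg_cong[OF F', of laurent_of_poly2] arg_cong[OF G', of laurent_of_poly2]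
    by (simp_all only: laurent_of_poly2_mult)
  ultimately have "f = u' * laurent_of_poly2 (gcd F G) * laurent_of_poly2 F'"
    "g = u' * laurent_of_poly2 (gcd F G) * laurent_of_poly2 G'"
    using F G by (metis mult.assoc mult.commute)+
  then show ?thesis using cp by blast
qed

section \<open>Coordinates and normal form in the Promislow group\<close>

text \<open>
  The group acts on \<open>\<real>\<^sup>3\<close> by isometries that preserve the coordinate directions, and an element is
  determined by the image of a base point. With suitable units on the axes the images are
  integral, the element \<open>(i, j, k)\<close> acts on the three axes by \<open>t \<mapsto> i + (-1)\<^sup>j t\<close>, \<open>t \<mapsto> j + (-1)\<^sup>i t\<close> and
  \<open>t \<mapsto> k + (-1)\<^sup>k t\<close>, and composition is the following product on \<open>\<int>\<^sup>3\<close>.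
\<close>

fun coord_mult :: "int \<times> int \<times> int \<Rightarrow> int \<times> int \<times> int \<Rightarrow> int \<times> int \<times> int" where
  "coord_mult (i, j, k) (i', j', k') =
    (i + parity_sign j * i', j + parity_sign i * j', k + parity_sign k * k')"

lemma coord_mult_assoc: "coord_mult (coord_mult u v) w = coord_mult u (coord_mult v w)"
  by (cases u; cases v; cases w) (auto simp: algebra_simps)

lemma coord_mult_0 [simp]: "coord_mult (0, 0, 0) u = u" "coord_mult u (0, 0, 0) = u"
  by (cases u; simp)+

fun letter_coords :: "gen \<times> bool \<Rightarrow> int \<times> int \<times> int" where
  "letter_coords (Gen_a, e) = (if e then 1 else - 1, 0, 1)"
| "letter_coords (Gen_b, e) = (0, if e then 1 else - 1, - 1)"

definition word_coords :: "gen word \<Rightarrow> int \<times> int \<times> int" where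
  "word_coords w = foldr (\<lambda>l. coord_mult (letter_coords l)) w (0, 0, 0)"

lemma word_coords_simps [simp]:
  "word_coords [] = (0, 0, 0)"
  "word_coords (l # w) = coord_mult (letter_coords l) (word_coords w)"
  by (simp_all add: word_coords_def)

lemma word_coords_append [simp]: "word_coords (v @ w) = coord_mult (word_coords v) (word_coords w)"
  by (induction v) (simp_all add: coord_mult_assoc)

lift_definition coords :: "promislow \<Rightarrow> int \<times> int \<times> int" is word_coords
proof -
  fix v w assume "pres_eq promislow_rels v w"
  then show "word_coords v = word_coords w"
  proof (induction rule: pres_eq.induct)
    case (cancel u x e v)
    have "coord_mult (letter_coords (x, e)) (letter_coords (x, \<not> e)) = (0, 0, 0)"
      by (cases x; cases e) simp_all
    then have "word_coords [(x, e), (x, \<not> e)] = (0, 0, 0)" by simp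
    then show ?case by (simp only: word_coords_append coord_mult_0)
  next
    case (relation l r u v)
    then have "word_coords l = word_coords r" by (auto simp: promislow_rels_def)
    then show ?case by simp
  qed simp_all
qed

lemma coords_add: "coords (g + h) = coord_mult (coords g) (coords h)"
  by transfer simp

lemma coords_0 [simp]: "coords 0 = (0, 0, 0)"
  by transfer simp

lemma coords_P_a [simp]: "coords P_a = (1, 0, 1)"
  by transfer simp

lemma coords_P_b [simp]: "coords P_b = (0, 1, - 1)"
  by transfer simp

text \<open>
  The multiple of an element of an additively written group by an integer.
\<close>

definition zmult :: "int \<Rightarrow> 'g::group_add \<Rightarrow> 'g" where
  "zmult n g = (if 0 \<le> n then ((+) g ^^ nat n) 0 else ((+) (- g) ^^ nat (- n)) 0)"

lemma zmult_0 [simp]: "zmult 0 g = 0"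
  by (simp add: zmult_def)

lemma zmult_left: "zmult (n + 1) g = g + zmult n g" "zmult (n - 1) g = - g + zmult n g"
proof -
  have 1: "zmult (n + 1) g = g + zmult n g" for n
  proof (cases "0 \<le> n")
    case True
    then have "nat (n + 1) = Suc (nat n)" by simp
    then show ?thesis using True by (simp add: zmult_def)
  next
    case False
    then have "nat (- n) = Suc (nat (- (n + 1)))" by simp
    then show ?thesis using False by (auto simp: zmult_def simp flip: add.assoc)
  qed
  show "zmult (n + 1) g = g + zmult n g" by (rule 1)
  show "zmult (n - 1) g = - g + zmult n g"
    using 1[of "n - 1"] by (simp flip: add.assoc)
qed

lemma zmult_commutes: "g + h = h + g \<Longrightarrow> zmult n g + h = h + zmult n g"
proof (induction n rule: int_induct[where k = 0])
  case (step1 i)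
  then show ?case by (metis add.assoc zmult_left(1))
next
  case (step2 i)
  have "- g + h = h + - g"
    by (metis step2.prems add.assoc add.left_neutral add.right_neutral left_minus right_minus)
  then show ?case using step2 by (metis add.assoc zmult_left(2))
qed simp

lemma zmult_right: "zmult (n + 1) g = zmult n g + g" "zmult (n - 1) g = zmult n g + - g"
  using zmult_left[of n g] zmult_commutes[of g g n] zmult_commutes[of g "- g" n] by simp_all

lemma coords_zmult_x: "coords (zmult i (P_a + P_a)) = (2 * i, 0, 0)"
proof (induction i rule: int_induct[where k = 0])
  case (step2 i)
  have "coords (zmult i (P_a + P_a)) = coord_mult (coords (P_a + P_a)) (coords (zmult (i - 1) (P_a + P_a)))"
    using zmult_left(1)[of "i - 1" "P_a + P_a"] by (simp flip: coords_add)
  then show ?case using step2 by (cases "coords (zmult (i - 1) (P_a + P_a))") (auto simp: coords_add)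
qed (simp_all add: zmult_left(1) coords_add)

lemma coords_zmult_y: "coords (zmult i (P_b + P_b)) = (0, 2 * i, 0)"
proof (induction i rule: int_induct[where k = 0])
  case (step2 i)
  have "coords (zmult i (P_b + P_b)) = coord_mult (coords (P_b + P_b)) (coords (zmult (i - 1) (P_b + P_b)))"
    using zmult_left(1)[of "i - 1" "P_b + P_b"] by (simp flip: coords_add)
  then show ?case using step2 by (cases "coords (zmult (i - 1) (P_b + P_b))") (auto simp: coords_add)
qed (simp_all add: zmult_left(1) coords_add)

text \<open>
  The index of the image of an element in the infinite dihedral quotient by \<open>\<langle>a\<^sup>2, b\<^sup>2\<rangle>\<close>; it is the
  third coordinate.
\<close>

definition layer_index :: "promislow \<Rightarrow> int" where
  "layer_index g = snd (snd (coords g))"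

lemma layer_index_add: "layer_index (g + h) = layer_index g + parity_sign (layer_index g) * layer_index h"
  unfolding layer_index_def coords_add by (cases "coords g"; cases "coords h") simp

lemma layer_index_simps [simp]: "layer_index 0 = 0" "layer_index P_a = 1" "layer_index P_b = - 1"
  by (simp_all add: layer_index_def)

lemma layer_index_zmult_c: "layer_index (zmult n (P_a + P_b)) = 2 * n"
proof (induction n rule: int_induct[where k = 0])
  case (step2 i)
  have "layer_index (zmult i (P_a + P_b)) = 2 + layer_index (zmult (i - 1) (P_a + P_b))"
    using zmult_left(1)[of "i - 1" "P_a + P_b"] by (simp add: layer_index_add)
  then show ?case using step2 by simp
qed (simp_all add: zmult_left(1) layer_index_add)

text \<open>
  The element \<open>a\<^sup>2\<^sup>i b\<^sup>2\<^sup>j\<close> for \<open>m = (i, j)\<close>.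
\<close>

definition translation :: "int \<times> int \<Rightarrow> promislow" where
  "translation m = zmult (fst m) (P_a + P_a) + zmult (snd m) (P_b + P_b)"

lemma coords_translation [simp]: "coords (translation m) = (2 * fst m, 2 * snd m, 0)"
  by (simp add: translation_def coords_add coords_zmult_x coords_zmult_y)

lemma relation_b: "P_b + (P_a + P_a) = - (P_a + P_a) + P_b"
    "P_b + - (P_a + P_a) = (P_a + P_a) + P_b"
  using promislow_relations(1)
   apply (metis add.assoc add.left_neutral left_minus minus_add minus_minus right_minus add.right_neutral)
  using promislow_relations(1)
  by (metis add.assoc add.left_neutral left_minus minus_minus right_minus)

lemma relation_a: "P_a + (P_b + P_b) = - (P_b + P_b) + P_a"
    "P_a + - (P_b + P_b) = (P_b + P_b) + P_a"
  using promislow_relations(2)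
   apply (metis add.assoc add.left_neutral left_minus minus_add minus_minus right_minus add.right_neutral)
  using promislow_relations(2)
  by (metis add.assoc add.left_neutral left_minus minus_minus right_minus)

lemma xy_commute: "(P_a + P_a) + (P_b + P_b) = (P_b + P_b) + (P_a + P_a)"
  by (metis add.assoc relation_a)

lemma commutes_minus: "g + h = h' + g \<Longrightarrow> g + - h = - h' + g"
  for g h h' :: "'a::group_add"
  by (metis add.assoc add.left_neutral add.right_neutral left_minus right_minus)

lemma translation_x: "\<exists>m'. translation m + s = translation m'" if "s = P_a + P_a \<or> s = - (P_a + P_a)"
proof -
  let ?x = "P_a + P_a" and ?y = "P_b + P_b"
  have c: "zmult n ?y + ?x = ?x + zmult n ?y" for n
    by (rule zmult_commutes[OF xy_commute[symmetric]])
  have "translation m + ?x = translation (fst m + 1, snd m)"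
    using c by (simp add: translation_def zmult_right add.assoc)
  moreover have "translation m + - ?x = translation (fst m - 1, snd m)"
    using commutes_minus[OF c] by (simp add: translation_def zmult_right(2) add.assoc del: minus_add add_uminus_conv_diff)
  ultimately show ?thesis using that by blast
qed

lemma translation_y: "\<exists>m'. translation m + s = translation m'" if "s = P_b + P_b \<or> s = - (P_b + P_b)"
proof -
  let ?y = "P_b + P_b"
  have "translation m + ?y = translation (fst m, snd m + 1)"
    by (simp add: translation_def zmult_right add.assoc)
  moreover have "translation m + - ?y = translation (fst m, snd m - 1)"
    by (simp add: translation_def zmult_right(2) add.assoc del: minus_add add_uminus_conv_diff)
  ultimately show ?thesis using that by blast
qed

lemma promislow_induct [case_names zero a a' b b']:
  assumes "P 0" "\<And>g. P g \<Longrightarrow> P (g + P_a)" "\<And>g. P g \<Longrightarrow> P (g + - P_a)"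
    "\<And>g. P g \<Longrightarrow> P (g + P_b)" "\<And>g. P g \<Longrightarrow> P (g + - P_b)"
  shows "P (g :: promislow)"
proof -
  have "P (abs_promislow w)" for w
  proof (induction w rule: rev_induct)
    case Nil
    then show ?case using assms(1) by (simp add: zero_promislow_def)
  next
    case (snoc l w)
    have snoc_eq: "abs_promislow (w @ [l]) = abs_promislow w + abs_promislow [l]"
      by (simp add: plus_promislow.abs_eq)
    have "abs_promislow [l] \<in> {P_a, - P_a, P_b, - P_b}"
    proof (cases l)
      case (Pair x e)
      then show ?thesis
        by (cases x; cases e) (simp_all add: P_a_def P_b_def uminus_promislow.abs_eq)
    qed
    then show ?case using assms(2-5)[OF snoc] unfolding snoc_eq by auto
  qed
  then show ?thesis by (metis Quotient_promislow Quotient_abs_rep)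
qed

lemma conjugate_translations:
  "g + (P_a + P_a) \<in> {(P_a + P_a) + g, - (P_a + P_a) + g}"
  "g + (P_b + P_b) \<in> {(P_b + P_b) + g, - (P_b + P_b) + g}"
proof -
  have step: "(g + h) + x \<in> {x + (g + h), - x + (g + h)}"
    if g: "g + x \<in> {x + g, - x + g}" and h: "h + x = x + h \<or> h + x = - x + h" for g h x :: promislow
  proof -
    have "g + - x \<in> {- x + g, x + g}"
      using g commutes_minus[of g x x] commutes_minus[of g x "- x"] by auto
    moreover obtain s where s: "s = x \<or> s = - x" "h + x = s + h" using h by blast
    ultimately have "g + s = x + g \<or> g + s = - x + g" using s(1) g by (elim disjE; simp; blast)
    then obtain t where t: "t = x \<or> t = - x" "g + s = t + g" by blast
    have "(g + h) + x = t + (g + h)" by (metis add.assoc s(2) t(2))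
    then show ?thesis using t(1) by auto
  qed
  have inv: "- h + x = x + - h \<or> - h + x = - x + - h"
    if "h + x = x + h \<or> h + x = - x + h" for h x :: promislow
    using that
  proof
    assume "h + x = x + h"
    then show ?thesis by (metis add.assoc add.left_neutral add.right_neutral left_minus right_minus)
  next
    assume "h + x = - x + h"
    then have "h + - x = x + h" using commutes_minus by fastforce
    then show ?thesis by (metis add.assoc add.left_neutral add.right_neutral left_minus right_minus)
  qed
  have ax: "P_a + (P_a + P_a) = (P_a + P_a) + P_a" and b_y: "P_b + (P_b + P_b) = (P_b + P_b) + P_b"
    by (simp_all add: add.assoc)
  show "g + (P_a + P_a) \<in> {(P_a + P_a) + g, - (P_a + P_a) + g}"
  proof (induction g rule: promislow_induct)
    case zero
    show ?case by simp
  next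
    case (a g)
    show ?case by (rule step[OF a disjI1[OF ax]])
  next
    case (a' g)
    show ?case by (rule step[OF a' inv[OF disjI1[OF ax]]])
  next
    case (b g)
    show ?case by (rule step[OF b disjI2[OF relation_b(1)]])
  next
    case (b' g)
    show ?case by (rule step[OF b' inv[OF disjI2[OF relation_b(1)]]])
  qed
  show "g + (P_b + P_b) \<in> {(P_b + P_b) + g, - (P_b + P_b) + g}"
  proof (induction g rule: promislow_induct)
    case zero
    show ?case by simp
  next
    case (a g)
    show ?case by (rule step[OF a disjI2[OF relation_a(1)]])
  next
    case (a' g)
    show ?case by (rule step[OF a' inv[OF disjI2[OF relation_a(1)]]])
  next
    case (b g)
    show ?case by (rule step[OF b disjI1[OF b_y]])
  next
    case (b' g)
    show ?case by (rule step[OF b' inv[OF disjI1[OF b_y]]])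
  qed
qed

text \<open>
  Every element is \<open>a\<^sup>2\<^sup>i b\<^sup>2\<^sup>j (a b)\<^sup>n\<close> or such an element times \<open>a\<close>: these elements are closed under
  multiplication by \<open>a\<^sup>2\<close> and \<open>b\<^sup>2\<close>, then by \<open>a\<close>, and by \<open>b\<close> because \<open>(a b)\<^sup>n b = (a b)\<^sup>n\<^sup>-\<^sup>1 a b\<^sup>2\<close>.
\<close>

lemma normal_form:
  "\<exists>m n e. g = translation m + (zmult n (P_a + P_b) + (if e then P_a else 0))"
proof -
  define nf where "nf g \<longleftrightarrow> (\<exists>m n e. g = translation m + (zmult n (P_a + P_b) + (if e then P_a else 0)))" for g
  have nf_s: "nf (g + s)"
    if "nf g" "s \<in> {P_a + P_a, - (P_a + P_a), P_b + P_b, - (P_b + P_b)}" for g s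
  proof -
    obtain m n e where g: "g = translation m + (zmult n (P_a + P_b) + (if e then P_a else 0))"
      using \<open>nf g\<close> unfolding nf_def by blast
    define r where "r = zmult n (P_a + P_b) + (if e then P_a else 0)"
    have "\<exists>s'\<in>{P_a + P_a, - (P_a + P_a), P_b + P_b, - (P_b + P_b)}. r + s = s' + r"
      using that(2) conjugate_translations[of r]
        commutes_minus[of r "P_a + P_a" "P_a + P_a"] commutes_minus[of r "P_a + P_a" "- (P_a + P_a)"]
        commutes_minus[of r "P_b + P_b" "P_b + P_b"] commutes_minus[of r "P_b + P_b" "- (P_b + P_b)"]
      by (metis (no_types, lifting) empty_iff insert_iff minus_minus)
    then obtain s' where s': "s' \<in> {P_a + P_a, - (P_a + P_a), P_b + P_b, - (P_b + P_b)}" "r + s = s' + r"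
      by blast
    obtain m' where "translation m + s' = translation m'"
      using translation_x translation_y s'(1) by (metis empty_iff insert_iff)
    then have "g + s = translation m' + r"
      unfolding g r_def[symmetric] by (metis add.assoc s'(2))
    then show ?thesis unfolding nf_def r_def by blast
  qed
  have nf_a: "nf (g + P_a)" if "nf g" for g
  proof -
    obtain m n e where g: "g = translation m + (zmult n (P_a + P_b) + (if e then P_a else 0))"
      using \<open>nf g\<close> unfolding nf_def by blast
    show ?thesis
    proof (cases e)
      case True
      have "nf (translation m + (zmult n (P_a + P_b) + 0))"
        unfolding nf_def by (intro exI[of _ m] exI[of _ n] exI[of _ False]) simp
      from nf_s[OF this, of "P_a + P_a"] show ?thesis by (simp add: g True add.assoc)
    next
      case False
      then show ?thesis unfolding nf_def g
        by (intro exI[of _ m] exI[of _ n] exI[of _ True]) (simp add: add.assoc)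
    qed
  qed
  have nf_b: "nf (g + P_b)" if "nf g" for g
  proof -
    obtain m n e where g: "g = translation m + (zmult n (P_a + P_b) + (if e then P_a else 0))"
      using \<open>nf g\<close> unfolding nf_def by blast
    show ?thesis
    proof (cases e)
      case True
      then show ?thesis unfolding nf_def g
        by (intro exI[of _ m] exI[of _ "n + 1"] exI[of _ False]) (simp add: zmult_right add.assoc)
    next
      case False
      have "nf (translation m + (zmult (n - 1) (P_a + P_b) + P_a))"
        unfolding nf_def by (intro exI[of _ m] exI[of _ "n - 1"] exI[of _ True]) simp
      from nf_s[OF this, of "P_b + P_b"] show ?thesis
        using zmult_right(1)[of "n - 1" "P_a + P_b"] by (simp add: g False add.assoc)
    qed
  qed
  have "nf g"
  proof (induction g rule: promislow_induct)
    case zero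
    show ?case unfolding nf_def
      by (intro exI[of _ "(0, 0)"] exI[of _ 0] exI[of _ False]) (simp add: translation_def)
  next
    case (a' g)
    have "g + - (P_a + P_a) + P_a = g + - P_a" by (simp add: add.assoc minus_add del: add_uminus_conv_diff)
    then show ?case using nf_a[OF nf_s[OF a', of "- (P_a + P_a)"]] by simp
  next
    case (b' g)
    have "g + - (P_b + P_b) + P_b = g + - P_b" by (simp add: add.assoc minus_add del: add_uminus_conv_diff)
    then show ?case using nf_b[OF nf_s[OF b', of "- (P_b + P_b)"]] by simp
  qed (use nf_a nf_b in auto)
  then show ?thesis unfolding nf_def .
qed

lemma layer_index_0_translation:
  assumes "layer_index g = 0" obtains m where "g = translation m"
proof -
  obtain m n e where g: "g = translation m + (zmult n (P_a + P_b) + (if e then P_a else 0))"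
    using normal_form by blast
  have "layer_index (translation m) = 0" by (simp add: layer_index_def)
  then have "2 * n + (if e then 1 else 0) = 0" using assms by (cases e) (simp_all add: g layer_index_add layer_index_zmult_c)
  moreover from this have "\<not> e" by (auto split: if_splits) presburger
  ultimately show ?thesis using that g by simp
qed

text \<open>
  Since the coordinates are faithful, identities in the group can be checked on them.
\<close>

lemma coords_inj: "coords g = coords h \<Longrightarrow> g = h"
proof -
  assume eq: "coords g = coords h"
  have "coords (g + - h) = coords (h + - h)" by (simp only: coords_add eq)
  then have c: "coords (g - h) = (0, 0, 0)" by simp
  then obtain m where m: "g - h = translation m" using layer_index_0_translation[of "g - h"] by (auto simp: layer_index_def)
  then have "m = (0, 0)" using c by (cases m) simp
  then show "g = h" using m by (simp add: translation_def)
qed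

lemma translation_add: "translation (m + n) = translation m + translation n"
  by (rule coords_inj) (simp add: coords_add)

lemma inj_translation: "inj translation"
proof (rule injI)
  fix m n assume "translation m = translation n"
  then have "coords (translation m) = coords (translation n)" by simp
  then show "m = n" by (simp add: prod_eq_iff)
qed

lemma P_a_translation: "P_a + translation m = translation (fst m, - snd m) + P_a"
  by (rule coords_inj) (simp add: coords_add)

lemma P_b_translation: "P_b + translation m = translation (- fst m, snd m) + P_b"
  by (rule coords_inj) (simp add: coords_add)

lemma P_a_P_a: "P_a + P_a = translation (1, 0)"
  by (rule coords_inj) (simp add: coords_add)

lemma P_b_P_b: "P_b + P_b = translation (0, 1)"
  by (rule coords_inj) (simp add: coords_add)

lemma layer_index_translation [simp]: "layer_index (translation m) = 0"
  by (simp add: layer_index_def)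

lemma ex_layer_index: "\<exists>g. layer_index g = k"
proof (cases "even k")
  case True
  then have "layer_index (zmult (k div 2) (P_a + P_b)) = k" by (simp add: layer_index_zmult_c)
  then show ?thesis by blast
next
  case False
  then have "layer_index (zmult (k div 2) (P_a + P_b) + P_a) = k" by (simp add: layer_index_zmult_c layer_index_add)
  then show ?thesis by blast
qed

lemma layer_index_minus: "layer_index (- g) = - parity_sign (layer_index g) * layer_index g"
  using layer_index_add[of g "- g"] by (auto split: if_splits)

section \<open>The group ring of the Promislow group\<close>

text \<open>
  The embedding of the Laurent polynomials with \<open>x \<mapsto> a\<^sup>2\<close> and \<open>y \<mapsto> b\<^sup>2\<close>.
\<close>

definition from_laurent :: "laurent \<Rightarrow> promislow \<Rightarrow>\<^sub>0 int" where
  "from_laurent = pushforward translation"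

text \<open>
  The support consists of elements of index \<open>k\<close>.
\<close>

definition in_layer :: "int \<Rightarrow> (promislow \<Rightarrow>\<^sub>0 int) \<Rightarrow> bool" where
  "in_layer k s \<longleftrightarrow> (\<forall>g\<in>Poly_Mapping.keys s. layer_index g = k)"

text \<open>
  The component of index \<open>k\<close>.
\<close>

definition layer_part :: "int \<Rightarrow> (promislow \<Rightarrow>\<^sub>0 int) \<Rightarrow> promislow \<Rightarrow>\<^sub>0 int" where
  "layer_part k = part (\<lambda>g. layer_index g = k)"

lemma in_layer_frag_of: "in_layer (layer_index g) (frag_of g)"
  by (simp add: in_layer_def)

lemma in_layer_mult:
  assumes "in_layer k s" "in_layer l t"
  shows "in_layer (k + parity_sign k * l) (s * t)"
  using assms keys_mult[of s t] unfolding in_layer_def by (fastforce simp: layer_index_add)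

lemma in_layer_0:
  assumes "in_layer 0 s" shows "\<exists>f. s = from_laurent f"
proof -
  have "Poly_Mapping.keys s \<subseteq> range translation"
    using assms layer_index_0_translation unfolding in_layer_def by blast
  then show ?thesis
  proof (induction s rule: frag_induction)
    case zero
    show ?case by (intro exI[of _ 0]) (simp add: from_laurent_def)
  next
    case (one g)
    then obtain m where "g = translation m" by blast
    then show ?case by (intro exI[of _ "frag_of m"]) (simp add: from_laurent_def)
  next
    case (diff s t)
    then obtain f g where "s = from_laurent f" "t = from_laurent g" by blast
    then show ?case by (intro exI[of _ "f - g"]) (simp add: from_laurent_def)
  qed
qed

lemma in_layer_coeff:
  assumes "in_layer (layer_index g) s" shows "\<exists>f. s = from_laurent f * frag_of g"
proof -
  have "in_layer 0 (s * frag_of (- g))"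
    using in_layer_mult[OF assms in_layer_frag_of[of "- g"]] by (simp add: layer_index_minus split: if_splits)
  then obtain f where "s * frag_of (- g) = from_laurent f" using in_layer_0 by blast
  then have "from_laurent f * frag_of g = s * (frag_of (- g) * frag_of g)" by (simp flip: mult.assoc)
  then show ?thesis by (auto simp: frag_of_mult intro: exI[of _ f])
qed

lemma layer_part_mult:
  assumes "in_layer k s"
  shows "layer_part j (s * v) = s * layer_part (parity_sign k * (j - k)) v"
proof -
  have "Poly_Mapping.keys s \<subseteq> {g. layer_index g = k}" using assms by (auto simp: in_layer_def)
  then show ?thesis
  proof (induction s rule: frag_induction)
    case (one g)
    show ?case
    proof (induction v rule: poly_mapping_int_induct)
      case (frag_of h)
      have "layer_index (g + h) = j \<longleftrightarrow> layer_index h = parity_sign k * (j - k)" using one by (auto simp: layer_index_add)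
      then show ?case by (simp add: frag_of_mult layer_part_def part_frag_of)
    qed (simp_all add: layer_part_def part_0 part_diff right_diff_distrib)
  qed (simp_all add: layer_part_def part_0 part_diff left_diff_distrib)
qed

text \<open>
  The weight for \<open>norm_x\<close> is the degree in \<open>x\<close>, which \<open>\<sigma>\<close> preserves, and for \<open>norm_y\<close> it is the
  degree in \<open>y\<close>, which \<open>\<tau>\<close> preserves.
\<close>

lemma promislow_crossed:
  "dihedral_crossed from_laurent (pushforward (\<lambda>m. (fst m, - snd m)))
    (pushforward (\<lambda>m. (- fst m, snd m))) laurent_x laurent_y (frag_of P_a) (frag_of P_b) in_layer layer_part"
proof
  show "from_laurent (f * g) = from_laurent f * from_laurent g" for f g
    unfolding from_laurent_def by (rule pushforward_mult[OF translation_add])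
  show "f = 0" if "from_laurent f = 0" for f
    using lookup_pushforward[OF inj_translation, of f] that by (intro poly_mapping_eqI) (simp add: from_laurent_def)
  show "frag_of P_a * from_laurent f = from_laurent (pushforward (\<lambda>m. (fst m, - snd m)) f) * frag_of P_a" for f
    unfolding from_laurent_def by (rule pushforward_intertwine) (rule P_a_translation)
  show "frag_of P_b * from_laurent f = from_laurent (pushforward (\<lambda>m. (- fst m, snd m)) f) * frag_of P_b" for f
    unfolding from_laurent_def by (rule pushforward_intertwine) (rule P_b_translation)
  show "f * pushforward (\<lambda>m. (fst m, - snd m)) f - laurent_x * (g * pushforward (\<lambda>m. (fst m, - snd m)) g) \<noteq> 0 \<and>
     \<not> f * pushforward (\<lambda>m. (fst m, - snd m)) f - laurent_x * (g * pushforward (\<lambda>m. (fst m, - snd m)) g) dvd 1"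
    if "f \<noteq> 0" "g \<noteq> 0" for f g
    using that by (intro norm_not_unit[where d = fst and z' = "(1, 0)"]) (auto intro: injI simp: prod_eq_iff)
  show "f * pushforward (\<lambda>m. (- fst m, snd m)) f - laurent_y * (g * pushforward (\<lambda>m. (- fst m, snd m)) g) \<noteq> 0 \<and>
     \<not> f * pushforward (\<lambda>m. (- fst m, snd m)) f - laurent_y * (g * pushforward (\<lambda>m. (- fst m, snd m)) g) dvd 1"
    if "f \<noteq> 0" "g \<noteq> 0" for f g
    using that by (intro norm_not_unit[where d = snd and z' = "(0, 1)"]) (auto intro: injI simp: prod_eq_iff)
  show "\<exists>c f' g'. f = c * f' \<and> g = c * g' \<and> coprime_pair f' g'" if "f \<noteq> 0 \<or> g \<noteq> 0" for f g :: laurent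
    using that by (rule laurent_primitive)
  show "in_layer 0 (from_laurent f)" for f
    using keys_pushforward[of translation f] by (auto simp: in_layer_def from_laurent_def)
  show "\<exists>w w'. w * w' = 1 \<and> w' * w = 1 \<and> (\<forall>s. in_layer k s \<longrightarrow> (\<exists>f. s = from_laurent f * w))" for k
  proof -
    obtain g where "layer_index g = k" using ex_layer_index by blast
    then show ?thesis using in_layer_coeff
      by (intro exI[of _ "frag_of g"] exI[of _ "frag_of (- g)"]) (auto simp: frag_of_mult)
  qed
  show "layer_part k s = s" if "in_layer k s" for k s
    using that by (intro poly_mapping_eqI) (auto simp: layer_part_def lookup_part in_layer_def in_keys_iff)
  show "layer_part j s = 0" if "in_layer k s" "j \<noteq> k" for j k s
    using that by (intro poly_mapping_eqI) (auto simp: layer_part_def lookup_part in_layer_def in_keys_iff)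
  show "v = 0" if "\<And>k. layer_part k v = 0" for v
  proof (rule poly_mapping_eqI)
    fix g
    show "Poly_Mapping.lookup v g = Poly_Mapping.lookup 0 g"
      using arg_cong[OF that[of "layer_index g"], of "\<lambda>v. Poly_Mapping.lookup v g"]
      by (simp add: layer_part_def lookup_part)
  qed
  show "finite {k. layer_part k v \<noteq> 0}" for v
  proof (rule finite_subset)
    show "{k. layer_part k v \<noteq> 0} \<subseteq> layer_index ` Poly_Mapping.keys v"
      by (auto simp: layer_part_def keys_part simp flip: keys_eq_empty)
  qed simp
  show "in_layer k (layer_part k v)" for k v
    by (simp add: in_layer_def layer_part_def keys_part)
  show "in_layer (k + parity_sign k * l) (s * t)" if "in_layer k s" "in_layer l t" for k l s t
    using that by (rule in_layer_mult)
  show "\<exists>f. s = from_laurent f" if "in_layer 0 s" for s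
    using that by (rule in_layer_0)
  show "layer_part j (s * v) = s * layer_part (parity_sign k * (j - k)) v" if "in_layer k s" for j k s v
    using that by (rule layer_part_mult)
  show "pushforward (\<lambda>m. (fst m, - snd m)) (f * g) = pushforward (\<lambda>m. (fst m, - snd m)) f * pushforward (\<lambda>m. (fst m, - snd m)) g"
    "pushforward (\<lambda>m. (- fst m, snd m)) (f * g) = pushforward (\<lambda>m. (- fst m, snd m)) f * pushforward (\<lambda>m. (- fst m, snd m)) g"
    for f g :: laurent
    by (rule pushforward_mult; simp)+
  have "translation 0 = 0" by (simp add: translation_def)
  then show "from_laurent 1 = 1"
    using pushforward_simps(2)[of translation 0] by (simp add: from_laurent_def)
qed (simp_all add: from_laurent_def pushforward_pushforward pushforward_id frag_of_mult
    P_a_P_a P_b_P_b frag_of_unit in_layer_def layer_part_def part_add)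

text \<open>
  Stated for arbitrary generators so that it applies to both orders of \<open>a\<close> and \<open>b\<close>.
\<close>

lemma monomial_trivial_unit:
  assumes "dihedral_crossed from_laurent \<sigma> \<tau> x y (frag_of g) (frag_of h) L pr"
    and "dihedral_crossed.monomial from_laurent (frag_of g) (frag_of h) s"
  shows "is_trivial_unit s"
proof -
  have "\<exists>k. s = frag_of k \<or> s = - frag_of k"
    using assms(2)
  proof (induction rule: dihedral_crossed.monomial.induct[OF assms(1), consumes 1])
    case (1 f)
    then obtain m where "f = frag_of m \<or> f = - frag_of m" by (rule laurent_unit)
    then have "from_laurent f = frag_of (translation m) \<or> from_laurent f = - frag_of (translation m)"
      using pushforward_simps(4)[of translation 0 "frag_of m"] by (auto simp: from_laurent_def)
    then show ?case by blast
  next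
    case (4 s t)
    then obtain k l where "s = frag_of k \<or> s = - frag_of k" "t = frag_of l \<or> t = - frag_of l" by blast
    then have "s * t = frag_of (k + l) \<or> s * t = - frag_of (k + l)"
      by (auto simp: frag_of_mult)
    then show ?case by blast
  qed blast+
  then show ?thesis unfolding is_trivial_unit_def .
qed

lemma layer_index_word_ball:
  assumes "g \<in> word_ball {P_a, P_b} n" shows "\<bar>layer_index g\<bar> \<le> int n"
proof -
  obtain xs where g: "g = sum_list xs" and xs: "set xs \<subseteq> {P_a, P_b} \<union> uminus ` {P_a, P_b}" "length xs \<le> n"
    using assms unfolding word_ball_def by blast
  have "\<bar>layer_index (sum_list xs)\<bar> \<le> int (length xs)"
    using xs(1)
  proof (induction xs)
    case (Cons l xs)
    have "\<bar>layer_index l\<bar> = 1" using Cons.prems by (auto simp: layer_index_minus)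
    then show ?case using Cons by (auto simp: layer_index_add)
  qed simp
  then show ?thesis using g xs(2) by simp
qed

text \<open>
  The ball of radius 3 enters only through the bound on the index, that is, on the length of the
  image in the infinite dihedral group.
\<close>

lemma unit_trivial_of_layers:
  fixes u :: "promislow \<Rightarrow>\<^sub>0 int"
  assumes uv: "u * v = 1" and small: "\<And>g. g \<in> Poly_Mapping.keys u \<Longrightarrow> \<bar>layer_index g\<bar> \<le> 3"
  shows "is_trivial_unit u"
proof -
  interpret PR: dihedral_crossed from_laurent "pushforward (\<lambda>m. (fst m, - snd m))"
    "pushforward (\<lambda>m. (- fst m, snd m))" laurent_x laurent_y "frag_of P_a" "frag_of P_b" in_layer layer_part
    by (rule promislow_crossed)
  let ?a = "frag_of P_a :: promislow \<Rightarrow>\<^sub>0 int" and ?b = "frag_of P_b :: promislow \<Rightarrow>\<^sub>0 int"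
  have coeff: "\<exists>f. layer_part k u = from_laurent f * frag_of g" if "layer_index g = k" for k g
    using in_layer_coeff[of g "layer_part k u"] PR.layer_pr[of k u] that by simp
  obtain p where p: "layer_part 0 u = from_laurent p" using in_layer_0 PR.layer_pr by blast
  obtain q where q: "layer_part 1 u = from_laurent q * ?a" using coeff[of P_a] by auto
  obtain r where r: "layer_part (- 1) u = from_laurent r * ?b" using coeff[of P_b] by auto
  obtain s where s: "layer_part 2 u = from_laurent s * (?a * ?b)"
    using coeff[of "P_a + P_b" 2] by (auto simp: layer_index_add frag_of_mult)
  obtain t where t: "layer_part (- 2) u = from_laurent t * (?b * ?a)"
    using coeff[of "P_b + P_a" "- 2"] by (auto simp: layer_index_add frag_of_mult)
  obtain m where m: "layer_part 3 u = from_laurent m * (?a * (?b * ?a))"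
    using coeff[of "P_a + (P_b + P_a)" 3] by (auto simp: layer_index_add frag_of_mult)
  obtain l where l: "layer_part (- 3) u = from_laurent l * (?b * (?a * ?b))"
    using coeff[of "P_b + (P_a + P_b)" "- 3"] by (auto simp: layer_index_add frag_of_mult)
  have "u = layer_part 0 u + layer_part 1 u + layer_part (- 1) u + layer_part 2 u + layer_part (- 2) u
      + layer_part 3 u + layer_part (- 3) u"
  proof (rule poly_mapping_eqI)
    fix g
    have "layer_index g \<in> {0, 1, - 1, 2, - 2, 3, - 3}" if "Poly_Mapping.lookup u g \<noteq> 0"
      using small[of g] that by (auto simp: in_keys_iff abs_le_iff)
    then show "Poly_Mapping.lookup u g = Poly_Mapping.lookup (layer_part 0 u + layer_part 1 u + layer_part (- 1) u
        + layer_part 2 u + layer_part (- 2) u + layer_part 3 u + layer_part (- 3) u) g"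
      by (cases "Poly_Mapping.lookup u g = 0") (auto simp: lookup_add layer_part_def lookup_part)
  qed
  then have u: "u = from_laurent p + from_laurent q * ?a + from_laurent r * ?b + from_laurent s * (?a * ?b)
      + from_laurent t * (?b * ?a) + from_laurent m * (?a * (?b * ?a)) + from_laurent l * (?b * (?a * ?b))"
    by (simp only: p q r s t m l)
  have "m = 0 \<or> l = 0" using PR.extremal_product[OF uv u] .
  then show ?thesis
  proof
    assume "l = 0"
    then have "PR.monomial u"
      using u by (intro PR.unit_monomial[OF uv, of p q r s t m]) simp
    then show ?thesis by (rule monomial_trivial_unit[OF promislow_crossed])
  next
    assume "m = 0"
    then have "dihedral_crossed.monomial from_laurent ?b ?a u"
      using u by (intro dihedral_crossed.unit_monomial[OF PR.swapped uv, of p r q t s l]) (simp add: ac_simps)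
    then show ?thesis by (rule monomial_trivial_unit[OF PR.swapped])
  qed
qed

theorem corollary4p1:
  fixes u :: "promislow \<Rightarrow>\<^sub>0 int"
  assumes "is_ring_unit u"
    and "Poly_Mapping.keys u \<subseteq> word_ball {P_a, P_b} 3"
  shows "is_trivial_unit u"
proof -
  obtain v where "u * v = 1" using assms(1) unfolding is_ring_unit_def by blast
  then show ?thesis
    by (rule unit_trivial_of_layers) (use assms(2) layer_index_word_ball[of _ 3] in auto)
qed

end
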